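(* For every integer $k \geq 3$ there exists a constant $\rho > 0$ depending only on $k$ such that for every integer $t \geq 2$ and every integer $m$ the following hold. (i) If $m \geq 128 \log^2 t$, then $r(K_{2,t},K_{2,t},K_m) \geq \rho\, \dfrac{m^2 t}{\log^4(mt)}$. (ii) If $m \geq 16 k \log t$, then $r_k(K_{2,t};K_m) \geq \rho\, \dfrac{m^2 t}{\log^2(mt)}$.
   Context: For graphs $H_1,\dots,H_\ell$, the multicolor Ramsey number $r(H_1,\dots,H_\ell)$ is the minimum integer $r$ such that in every edge-coloring of the complete graph $K_r$ with $\ell$ colors there is a monochromatic copy of $H_i$ in color $i$ for some $1\le i\le \ell$ (copies are not necessarily induced subgraphs). For $k\ge 1$, $r_k(H;G)$ denotes $r(H,\dots,H,G)$ with $H$ repeated $k$ times. $K_{2,t}$ is the complete bipartite graph with parts of sizes $2$ and $t$; $K_m$ is the complete graph on $m$ vertices. Logarithms are natural, and $\log^j x$ means $(\log x)^j$. *)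

theory Defs
  imports Complex_Main "HOL-Library.Ramsey"
begin

record 'a graph =
  verts :: "'a set"
  edges :: "'a set set"

definition complete_graph :: "nat \<Rightarrow> nat graph" where
  "complete_graph n = \<lparr>verts = {..<n}, edges = [{..<n}]\<^bsup>2\<^esup>\<rparr>"

definition complete_bipartite_graph :: "nat \<Rightarrow> nat \<Rightarrow> nat graph" where
  "complete_bipartite_graph s t =
     \<lparr>verts = {..<s + t}, edges = {{i, j} | i j. i < s \<and> s \<le> j \<and> j < s + t}\<rparr>"

(* Not necessarily induced copies. *)
definition has_copy :: "'a graph \<Rightarrow> 'b graph \<Rightarrow> bool" where
  "has_copy G H \<longleftrightarrow>
     (\<exists>f. inj_on f (verts H) \<and> f ` verts H \<subseteq> verts G \<and> (\<forall>e \<in> edges H. f ` e \<in> edges G))"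

definition colour_class :: "'a graph \<Rightarrow> ('a set \<Rightarrow> nat) \<Rightarrow> nat \<Rightarrow> 'a graph" where
  "colour_class G c i = \<lparr>verts = verts G, edges = {e \<in> edges G. c e = i}\<rparr>"

(* Every edge colouring of K_r with the colours 0, ..., length Hs - 1
   has a copy of Hs ! i in colour i, for some i. *)
definition ramsey_property :: "nat \<Rightarrow> nat graph list \<Rightarrow> bool" where
  "ramsey_property r Hs \<longleftrightarrow>
     (\<forall>c \<in> edges (complete_graph r) \<rightarrow> {..<length Hs}.
        \<exists>i < length Hs. has_copy (colour_class (complete_graph r) c i) (Hs ! i))"

definition ramsey_number :: "nat graph list \<Rightarrow> nat" where
  "ramsey_number Hs = (LEAST r. ramsey_property r Hs)"

definition ramsey_number_rep :: "nat \<Rightarrow> nat graph \<Rightarrow> nat graph \<Rightarrow> nat" where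
  "ramsey_number_rep k H G = ramsey_number (replicate k H @ [G])"

(* The minimum in the definition of ramsey_number is attained for finite simple graphs. *)

lemma ramsey_property_exists:
  assumes "\<And>H. H \<in> set Hs \<Longrightarrow> finite (verts H) \<and> edges H \<subseteq> [verts H]\<^bsup>2\<^esup>"
  shows "\<exists>r. ramsey_property r Hs"
proof -
  define qs where "qs = map (\<lambda>H. card (verts H)) Hs"
  obtain N :: nat where N: "partn_lst {..<N} qs 2"
    using ramsey_full by blast
  have "\<exists>i < length Hs. has_copy (colour_class (complete_graph N) c i) (Hs ! i)"
    if c: "c \<in> edges (complete_graph N) \<rightarrow> {..<length Hs}" for c
  proof -
    have "c \<in> [{..<N}]\<^bsup>2\<^esup> \<rightarrow> {..<length qs}"
      using c by (simp add: complete_graph_def qs_def)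
    then obtain i S where i: "i < length qs" and S: "S \<in> nsets {..<N} (qs ! i)"
      and mono: "c ` nsets S 2 \<subseteq> {i}"
      using N unfolding partn_lst_def monochromatic_def by blast
    define H where "H = Hs ! i"
    have i': "i < length Hs" using i by (simp add: qs_def)
    then have H: "finite (verts H)" "edges H \<subseteq> [verts H]\<^bsup>2\<^esup>"
      using assms[of H] by (auto simp: H_def)
    have S': "S \<subseteq> {..<N}" "finite S" "card S = card (verts H)"
      using S i' by (auto simp: nsets_def qs_def H_def)
    obtain f where f: "bij_betw f (verts H) S"
      using H(1) S' by (metis finite_same_card_bij)
    have "f ` e \<in> [S]\<^bsup>2\<^esup>" if "e \<in> edges H" for e
    proof -
      have e: "e \<subseteq> verts H" "card e = 2" "finite e"
        using H(2) that by (auto simp: nsets_def)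
      then have "card (f ` e) = 2"
        using f by (metis bij_betw_def card_image inj_on_subset)
      then show ?thesis
        using e f by (auto simp: nsets_def bij_betw_def)
    qed
    then have "f ` e \<in> [{..<N}]\<^bsup>2\<^esup> \<and> c (f ` e) = i" if "e \<in> edges H" for e
      using that mono nsets_mono[OF S'(1)] by blast
    then have "has_copy (colour_class (complete_graph N) c i) H"
      using f S'(1) unfolding has_copy_def colour_class_def complete_graph_def bij_betw_def
      by auto
    then show ?thesis using i' H_def by blast
  qed
  then show ?thesis unfolding ramsey_property_def by blast
qed

end

theory Submission
  imports Defs "HOL-Algebra.Algebraic_Closure_Type" "HOL-Combinatorics.Permutations" "HOL-Library.Z2"
begin

text \<open>
  Let K be the field of order q = 2^a, V an additive subgroup of order s = 2^b, and join (x, A) and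
  (y, B) in K \<times> K/V when xy lies in A + B. This graph has n = q^2/s vertices, is q-regular, and
  distinct vertices have at most s common neighbours, so it contains no K_{2,t} for t > s. Its edges
  are evenly distributed by a second moment count, which bounds the number of independent m-sets by
  n^L (3q^{3/2}/s)^m/m! with L about (2q/s) log n. For j + 1 randomly permuted copies of the graph
  (two for (i), three for (ii)), the expected number of m-sets independent in all of them is then
  below 1 once sm is at least a constant times q (log q)^{3-j}; every pair outside these
  copies gets the last colour. If s and q are the largest powers of 2 allowed by t and m, then n is
  of the required order; if this would force q < 4s, then m is so small that the bound r > t suffices.
\<close>

subsection \<open>A graph with small codegrees\<close>

text \<open>Why two copies cost (log q)^2 and three only log q: on average, the j + 1 permuted
  copies share I^(j+1) / C^j independent m-sets, where I counts those of one copy and C = (n choose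
  m) is at least (n/m)^m. Apart from the factor n^(L(j+1)), this is bounded by the m-th power of a
  constant times (q^(3/2)/(sm))^(j+1) (sm/q^2)^j. For j = 1 the base is q/(sm), so a large constant
  ratio sm/q only gains a factor 1/e per vertex, and m must beat L log n, of order (q/s)(log q)^2.
  For j = 2 the base is sqrt q/(sm), at most about q^(-1/2), so each vertex gains (log q)/2 in the
  exponent and one logarithm is saved. Solving for q and inserting it into n = q^2/s squares the
  logarithm: exponents 4 and 2. Characteristic 2 makes negation trivial, so cosets are compared by
  sums, and powers of 2 lose only constant factors against general t and m. A vertex (x, A) is
  adjacent to itself when x^2 lies in V. These loops are kept: they make every degree exactly q, can
  only raise the codegrees that are bounded anyway, and do not affect colourings, which see distinct
  pairs only.\<close>

text \<open>Over an algebraically closed field \<open>p\<close> splits into linear factors; a factor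
  occurring twice would give a common root of \<open>p\<close> and \<open>pderiv p\<close>.\<close>

lemma card_roots_of_separable:
  fixes p :: "'a :: alg_closed_field poly"
  assumes "p \<noteq> 0" and sep: "\<And>x. poly p x = 0 \<Longrightarrow> poly (pderiv p) x \<noteq> 0"
  shows "card {x. poly p x = 0} = degree p"
proof -
  obtain A where A: "size A = degree p" "p = smult (lead_coeff p) (\<Prod>x\<in>#A. [:-x, 1:])"
    using alg_closed_imp_factorization[OF assms(1)] by blast
  have lc: "lead_coeff p \<noteq> 0" using assms(1) by simp
  have roots: "{x. poly p x = 0} = set_mset A"
    by (subst A(2)) (use lc in \<open>auto simp: poly_prod_mset prod_mset_zero_iff\<close>)
  have "count A x = 1" if xA: "x \<in># A" for x
  proof (rule ccontr)
    assume "count A x \<noteq> 1"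
    obtain B where B: "A = add_mset x B" using multi_member_split[OF xA] by blast
    with \<open>count A x \<noteq> 1\<close> have "x \<in># B" by (auto intro: count_inI)
    from multi_member_split[OF this] obtain C where C: "B = add_mset x C" by blast
    have "p = [:-x, 1:] * ([:-x, 1:] * smult (lead_coeff p) (\<Prod>x\<in>#C. [:-x, 1:]))"
      by (subst A(2)) (simp add: B C)
    then obtain r where r: "p = [:-x, 1:] * ([:-x, 1:] * r)" by blast
    have "poly p x = 0" "poly (pderiv p) x = 0"
      unfolding r pderiv_mult by simp_all
    with sep show False by blast
  qed
  then have "size A = card (set_mset A)"
    by (simp add: size_multiset_overloaded_eq)
  with A(1) roots show ?thesis by simp
qed

lemma freshman_dream_2:
  fixes x y :: "'a :: comm_ring_1"
  assumes "(1 :: 'a) + 1 = 0"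
  shows "(x + y) ^ 2 ^ a = x ^ 2 ^ a + y ^ 2 ^ a"
proof (induction a)
  case (Suc a)
  have two: "(2 :: 'a) = 0" using assms by simp
  have "(x + y) ^ 2 ^ Suc a = ((x + y) ^ 2 ^ a)\<^sup>2"
    by (simp add: power_mult[symmetric] mult.commute)
  also have "\<dots> = (x ^ 2 ^ a)\<^sup>2 + (y ^ 2 ^ a)\<^sup>2"
    unfolding Suc power2_sum by (simp add: two)
  finally show ?case by (simp add: power_mult[symmetric] mult.commute)
qed simp

text \<open>K is the root set of X^(2^a) - X in the algebraic closure of the two-element field,
  closed under sums because the 2^a-th power is additive. Closure under sums and products is enough
  to record, since cancellation takes place in the ambient field.\<close>

lemma exists_subfield_of_order_2_power:
  assumes "a > 0"
  shows "\<exists>K :: bit alg_closure set. card K = 2 ^ a \<and> 0 \<in> K \<and>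
    (\<forall>x\<in>K. \<forall>y\<in>K. x + y \<in> K \<and> x * y \<in> K)"
proof -
  define p :: "bit alg_closure poly" where "p = monom 1 (2 ^ a) - monom 1 1"
  define K where "K = {x. poly p x = 0}"
  have char2: "(1 :: bit alg_closure) + 1 = 0"
    using to_ac_add[of "1::bit" 1] by simp
  have K: "x \<in> K \<longleftrightarrow> x ^ 2 ^ a = x" for x
    by (simp add: K_def p_def poly_monom)
  have a1: "(1::nat) < 2 ^ a" using assms one_less_power[of "2::nat" a] by simp
  have deg: "degree p = 2 ^ a"
    unfolding p_def diff_conv_add_uminus
    by (subst degree_add_eq_left) (use a1 in \<open>auto simp: degree_monom_eq\<close>)
  \<comment> \<open>Hence the derivative is the constant -1 and all 2^a roots are distinct.\<close>
  have "of_nat (2 ^ a) = (0 :: bit alg_closure)"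
    using char2 assms by (simp add: zero_power)
  moreover have "poly (pderiv p) x = of_nat (2 ^ a) * x ^ (2 ^ a - 1) - 1" for x
    by (simp add: p_def pderiv_diff pderiv_monom poly_monom del: of_nat_power)
  ultimately have "poly (pderiv p) x = - 1" for x by (simp only: mult_zero_left diff_0)
  moreover have "p \<noteq> 0" using deg by auto
  ultimately have "card K = 2 ^ a"
    unfolding K_def using card_roots_of_separable[of p] deg by simp
  moreover have "0 \<in> K" by (simp add: K)
  moreover have "x + y \<in> K \<and> x * y \<in> K" if "x \<in> K" "y \<in> K" for x y
    using that by (simp add: K freshman_dream_2[OF char2] power_mult_distrib)
  ultimately show ?thesis by blast
qed

(* Negation is the identity in the groups of exponent 2 considered here. *)
definition subgroup2 :: "'a :: ab_group_add set \<Rightarrow> bool" where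
  "subgroup2 V \<longleftrightarrow> finite V \<and> 0 \<in> V \<and> (\<forall>x\<in>V. \<forall>y\<in>V. x + y \<in> V)"

text \<open>K is a vector space over the two-element field, and V grows by one dimension at a time:
  for v outside V, the union of V and v + V is closed under addition because v + v = 0, and it has
  twice the order.\<close>

lemma exists_subgroup2_of_order:
  fixes K :: "'a :: ab_group_add set"
  assumes char2: "\<And>x::'a. x + x = 0" and K: "subgroup2 K" "card K = 2 ^ a" and "b \<le> a"
  shows "\<exists>V. subgroup2 V \<and> V \<subseteq> K \<and> card V = 2 ^ b"
  using \<open>b \<le> a\<close>
proof (induction b)
  case 0
  have "subgroup2 {0::'a}" by (simp add: subgroup2_def)
  then show ?case using K by (intro exI[of _ "{0}"]) (auto simp: subgroup2_def)
next
  case (Suc b)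
  then obtain V where V: "subgroup2 V" "V \<subseteq> K" "card V = 2 ^ b" by auto
  have "card V < card K" using V K Suc.prems by simp
  then obtain v where v: "v \<in> K" "v \<notin> V" using V(2) by (metis less_irrefl subsetI subset_antisym)
  have add_cancel: "v + x + (v + y) = x + y" for x y
    using char2[of v] by (metis (no_types) add.assoc add.commute add_0)
  have notin: "v + x \<notin> V" if "x \<in> V" for x
  proof
    assume "v + x \<in> V"
    then have "v + x + x \<in> V" using V(1) that by (simp add: subgroup2_def)
    then show False using v char2[of x] by (simp add: add.assoc)
  qed
  define W where "W = V \<union> (+) v ` V"
  have "subgroup2 W"
    unfolding subgroup2_def
  proof (intro conjI ballI)
    show "finite W" "0 \<in> W" using V(1) by (auto simp: W_def subgroup2_def)
    fix x y assume "x \<in> W" "y \<in> W"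
    have Va: "\<And>x y. x \<in> V \<Longrightarrow> y \<in> V \<Longrightarrow> x + y \<in> V" using V(1) by (simp add: subgroup2_def)
    consider "x \<in> V" "y \<in> V" | x' where "x = v + x'" "x' \<in> V" "y \<in> V"
      | y' where "x \<in> V" "y = v + y'" "y' \<in> V"
      | x' y' where "x = v + x'" "x' \<in> V" "y = v + y'" "y' \<in> V"
      using \<open>x \<in> W\<close> \<open>y \<in> W\<close> unfolding W_def by blast
    then have "x + y \<in> V \<or> (\<exists>z\<in>V. x + y = v + z)"
    proof cases
      case 2
      then show ?thesis using Va by (auto simp: add.assoc)
    next
      case 3
      then show ?thesis using Va by (auto simp: add.left_commute)
    next
      case 4
      then show ?thesis using Va by (simp add: add_cancel)
    qed (use Va in blast)
    then show "x + y \<in> W" unfolding W_def by blast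
  qed
  moreover have "W \<subseteq> K" using V K v by (auto simp: W_def subgroup2_def)
  moreover have "card W = 2 ^ Suc b"
  proof -
    have "V \<inter> (+) v ` V = {}" using notin by auto
    then have "card W = card V + card ((+) v ` V)"
      unfolding W_def using V(1) by (intro card_Un_disjoint) (auto simp: subgroup2_def)
    also have "card ((+) v ` V) = card V" by (simp add: card_image)
    finally show ?thesis using V(3) by simp
  qed
  ultimately show ?case by blast
qed

text \<open>Choosing representatives lets elements of K stand for the cosets of V, so no quotient
  type is needed. As -w = w, the condition z + w \<in> V says that z and w lie in the same
  coset.\<close>

lemma exists_transversal:
  fixes K :: "'a :: ab_group_add set"
  assumes char2: "\<And>x::'a. x + x = 0" and K: "subgroup2 K" and V: "subgroup2 V" "V \<subseteq> K"
  shows "\<exists>W\<subseteq>K. card W * card V = card K \<and> (\<forall>z\<in>K. \<exists>!w. w \<in> W \<and> z + w \<in> V)"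
proof -
  have Va: "\<And>x y. x \<in> V \<Longrightarrow> y \<in> V \<Longrightarrow> x + y \<in> V" using V(1) by (simp add: subgroup2_def)
  have Ka: "\<And>x y. x \<in> K \<Longrightarrow> y \<in> K \<Longrightarrow> x + y \<in> K" using K by (simp add: subgroup2_def)
  have cancel: "x + (x + y) = y" for x y :: 'a
    using char2[of x] by (metis add.assoc add_0)
  define r where "r z = (SOME w. w \<in> K \<and> z + w \<in> V)" for z
  have r: "r z \<in> K \<and> z + r z \<in> V" if "z \<in> K" for z
  proof -
    have "z \<in> K \<and> z + z \<in> V" using that char2[of z] V by (simp add: subgroup2_def)
    then show ?thesis unfolding r_def by (rule someI)
  qed
  have r_eq: "r z = r z'" if "z + z' \<in> V" for z z'
  proof -
    \<comment> \<open>The predicate under \<open>SOME\<close> depends only on the coset of z, so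
      equal cosets receive the same representative.\<close>
    have "z + w \<in> V \<longleftrightarrow> z' + w \<in> V" for w
      using Va[OF that, of "z + w"] Va[OF that, of "z' + w"]
      by (metis cancel add.assoc add.commute)
    then show ?thesis by (simp add: r_def)
  qed
  define W where "W = r ` K"
  have WK: "W \<subseteq> K" using r by (auto simp: W_def)
  have unique: "\<exists>!w. w \<in> W \<and> z + w \<in> V" if "z \<in> K" for z
  proof (rule ex1I[of _ "r z"])
    show "r z \<in> W \<and> z + r z \<in> V" using r that by (auto simp: W_def)
    fix w assume w: "w \<in> W \<and> z + w \<in> V"
    then obtain y where y: "y \<in> K" "w = r y" by (auto simp: W_def)
    have "(z + w) + (y + w) \<in> V" using w y r Va by blast
    then have "z + y \<in> V" using cancel by (metis add.assoc add.commute)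
    then show "w = r z" using r_eq y by simp
  qed
  have "bij_betw (\<lambda>(w, v). w + v) (W \<times> V) K"
  proof (rule bij_betwI')
    fix x y assume "x \<in> W \<times> V" "y \<in> W \<times> V"
    then obtain w v w' v' where xy: "x = (w, v)" "y = (w', v')"
      and mem: "w \<in> W" "v \<in> V" "w' \<in> W" "v' \<in> V" by auto
    have "w = w'" if "w + v = w' + v'"
    proof -
      have "(w + v) + w \<in> V" using mem cancel by (metis add.commute)
      moreover have "(w + v) + w' \<in> V" using mem cancel that by (metis add.commute)
      moreover have "w + v \<in> K" using mem WK V(2) Ka by blast
      ultimately show ?thesis using unique mem by blast
    qed
    then show "((case x of (w, v) \<Rightarrow> w + v) = (case y of (w, v) \<Rightarrow> w + v)) = (x = y)"
      using xy by auto
  next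
    fix x assume "x \<in> W \<times> V"
    then show "(case x of (w, v) \<Rightarrow> w + v) \<in> K" using WK V(2) Ka by auto
  next
    fix z assume "z \<in> K"
    then have "r z \<in> W" "z + r z \<in> V" "z = r z + (z + r z)"
      using r W_def cancel by (auto simp: add.left_commute char2)
    then show "\<exists>x\<in>W \<times> V. z = (case x of (w, v) \<Rightarrow> w + v)"
      by (intro bexI[of _ "(r z, z + r z)"]) auto
  qed
  then have "card W * card V = card K"
    using bij_betw_same_card card_cartesian_product by metis
  moreover have "\<forall>z\<in>K. \<exists>!w. w \<in> W \<and> z + w \<in> V" by (intro ballI unique)
  ultimately show ?thesis using WK by (intro exI[of _ W] conjI)
qed

section \<open>The graph on K \<times> K/V\<close>

definition common_nbrs :: "'a set \<Rightarrow> ('a \<Rightarrow> 'a \<Rightarrow> bool) \<Rightarrow> 'a \<Rightarrow> 'a \<Rightarrow> 'a set" where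
  "common_nbrs Y E u v = {w \<in> Y. E u w \<and> E v w}"

text \<open>For a fixed vertex, each y in K determines the coset of its neighbour (y, B), which
  gives degree q. For two vertices, adding their adjacency conditions eliminates B and leaves one
  linear condition on y modulo V, with at most s solutions. At the end the graph is transported from
  pairs to \<open>{..<n}\<close>.\<close>

lemma exists_small_codegree_graph:
  assumes "a > 0" "b \<le> a"
  shows "\<exists>E :: nat \<Rightarrow> nat \<Rightarrow> bool. symp E \<and>
    (\<forall>u<2 ^ (2 * a - b). card {v \<in> {..<2 ^ (2 * a - b)}. E u v} = 2 ^ a) \<and>
    (\<forall>u<2 ^ (2 * a - b). \<forall>v<2 ^ (2 * a - b). u \<noteq> v \<longrightarrow>
       card (common_nbrs {..<2 ^ (2 * a - b)} E u v) \<le> 2 ^ b)"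
proof -
  obtain K :: "bit alg_closure set" where K: "card K = 2 ^ a" "0 \<in> K"
    "\<And>x y. x \<in> K \<Longrightarrow> y \<in> K \<Longrightarrow> x + y \<in> K" "\<And>x y. x \<in> K \<Longrightarrow> y \<in> K \<Longrightarrow> x * y \<in> K"
    using exists_subfield_of_order_2_power[OF assms(1)] by blast
  have finK: "finite K" using K(1) by (intro card_ge_0_finite) simp
  have subK: "subgroup2 K" using K finK by (simp add: subgroup2_def)
  have char2: "x + x = 0" for x :: "bit alg_closure"
  proof -
    have "(1 + 1) * x = 0" using to_ac_add[of "1::bit" 1] by simp
    then show ?thesis by (simp only: distrib_right mult_1)
  qed
  have cancel: "x + (x + y) = y" for x y :: "bit alg_closure"
    using char2[of x] by (metis add.assoc add_0)
  obtain V where V: "subgroup2 V" "V \<subseteq> K" "card V = 2 ^ b"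
    using exists_subgroup2_of_order[OF char2 subK K(1) assms(2)] by blast
  have Va: "\<And>x y. x \<in> V \<Longrightarrow> y \<in> V \<Longrightarrow> x + y \<in> V" using V(1) by (simp add: subgroup2_def)
  have finV: "finite V" using V(1) by (simp add: subgroup2_def)
  obtain W where W: "W \<subseteq> K" "card W * card V = card K"
    and W_unique: "\<forall>z\<in>K. \<exists>!w. w \<in> W \<and> z + w \<in> V"
    using exists_transversal[OF char2 subK V(1,2)] by (elim exE conjE)
  note unique = bspec[OF W_unique]
  have finW: "finite W" using W finK finite_subset by blast
  (* The transversal W represents the quotient K/V. *)
  define Y where "Y = K \<times> W"
  define A where "A = (\<lambda>(x, w) (y, w'). x * y + (w + w') \<in> V)"
  have A_eq: "A (x, w) (y, w') \<longleftrightarrow> x * y + (w + w') \<in> V" for x w y w'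
    by (simp add: A_def)
  define n :: nat where "n = 2 ^ (2 * a - b)"
  have finY: "finite Y" by (simp add: Y_def finK finW)
  have "card Y * 2 ^ b = 2 ^ (2 * a)"
    using W(2) K(1) V(3) by (simp add: Y_def card_cartesian_product power_add mult_2)
  also have "\<dots> = n * 2 ^ b" using assms(2) by (simp add: n_def power_add[symmetric])
  finally have cardY: "card Y = n" by simp
  have deg: "card {v \<in> Y. A u v} = 2 ^ a" if u: "u \<in> Y" for u
  proof -
    obtain x w where xw: "u = (x, w)" "x \<in> K" "w \<in> W" using u by (auto simp: Y_def)
    have ex1: "\<exists>!w'. w' \<in> W \<and> x * y + (w + w') \<in> V" if "y \<in> K" for y
    proof -
      have "x * y + w \<in> K" using xw that W K by blast
      from unique[OF this] show ?thesis by (simp add: add.assoc)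
    qed
    have "bij_betw fst {v \<in> Y. A u v} K"
      unfolding bij_betw_def
    proof
      show "inj_on fst {v \<in> Y. A u v}"
      proof (rule inj_onI)
        fix v v' assume v: "v \<in> {v \<in> Y. A u v}" "v' \<in> {v \<in> Y. A u v}" "fst v = fst v'"
        then obtain y z z' where yz: "v = (y, z)" "v' = (y, z')" by (metis prod.collapse)
        with v have "y \<in> K" "z \<in> W \<and> x * y + (w + z) \<in> V" "z' \<in> W \<and> x * y + (w + z') \<in> V"
          by (simp_all add: Y_def xw A_eq)
        with ex1 have "z = z'" by blast
        with yz show "v = v'" by simp
      qed
      show "fst ` {v \<in> Y. A u v} = K"
      proof
        show "K \<subseteq> fst ` {v \<in> Y. A u v}"
        proof
          fix y assume "y \<in> K"
          then obtain w' where "w' \<in> W" "x * y + (w + w') \<in> V" using ex1 by blast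
          then have "(y, w') \<in> {v \<in> Y. A u v}" using \<open>y \<in> K\<close> by (simp add: Y_def A_eq xw)
          then show "y \<in> fst ` {v \<in> Y. A u v}" by (metis fst_conv imageI)
        qed
      qed (auto simp: Y_def)
    qed
    then show ?thesis using K(1) bij_betw_same_card by metis
  qed
  have codeg: "card (common_nbrs Y A u v) \<le> 2 ^ b" if u: "u \<in> Y" "v \<in> Y" "u \<noteq> v" for u v
  proof -
    obtain x w x' w' where xw: "u = (x, w)" "x \<in> K" "w \<in> W" "v = (x', w')" "x' \<in> K" "w' \<in> W"
      using u by (auto simp: Y_def)
    \<comment> \<open>This is the sum of the two adjacency conditions; z drops out since z + z =
      0.\<close>
    define g where "g = (\<lambda>(y, z :: bit alg_closure). (x + x') * y + (w + w'))"
    have gV: "g ` common_nbrs Y A u v \<subseteq> V"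
    proof
      fix c assume "c \<in> g ` common_nbrs Y A u v"
      then obtain p where p: "p \<in> common_nbrs Y A u v" "c = g p" by blast
      obtain y z where "p = (y, z)" by (cases p)
      with p have yz: "c = (x + x') * y + (w + w')"
        "x * y + (w + z) \<in> V" "x' * y + (w' + z) \<in> V"
        by (simp_all add: common_nbrs_def xw A_eq g_def)
      have "(x * y + (w + z)) + (x' * y + (w' + z)) = (x + x') * y + (w + w') + (z + z)"
        by (simp only: distrib_right add_ac)
      also have "\<dots> = c" by (simp only: char2 add_0_right yz(1))
      finally show "c \<in> V" using Va[OF yz(2,3)] by simp
    qed
    show ?thesis
    proof (cases "x = x'")
      \<comment> \<open>With equal first coordinates a common neighbour would put w and w' in the
        same coset, hence make the two vertices equal.\<close>
      case True
      have "common_nbrs Y A u v = {}"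
      proof (rule ccontr)
        assume "common_nbrs Y A u v \<noteq> {}"
        then obtain y z where "(y, z) \<in> common_nbrs Y A u v" by auto
        then have "w + w' \<in> V" using gV by (auto simp: g_def True char2)
        moreover have "w + w \<in> V" using V(1) by (simp add: char2 subgroup2_def)
        ultimately have "w = w'" using unique[of w] xw W by blast
        then show False using True u xw by simp
      qed
      then show ?thesis by simp
    next
      case False
      have "x + x' \<noteq> 0" using False cancel[of x x'] by (metis add_0_right)
      \<comment> \<open>The value of \<open>g\<close> determines y since x + x' is nonzero, and y
        determines the representative z.\<close>
      have "inj_on g (common_nbrs Y A u v)"
      proof (rule inj_onI)
        fix p p' assume p: "p \<in> common_nbrs Y A u v" "p' \<in> common_nbrs Y A u v" "g p = g p'"
        obtain y z y' z' where yz: "p = (y, z)" "p' = (y', z')" by (cases p; cases p')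
        have "(x + x') * y = (x + x') * y'" using p(3) by (simp add: g_def yz)
        then have "y = y'" using \<open>x + x' \<noteq> 0\<close> mult_left_cancel by blast
        have "y \<in> K" "z \<in> W" "z' \<in> W" "x * y + w + z \<in> V" "x * y + w + z' \<in> V"
          using p by (simp_all add: common_nbrs_def Y_def xw A_eq yz \<open>y = y'\<close> add.assoc)
        moreover have "x * y + w \<in> K" using xw W K \<open>y \<in> K\<close> by blast
        ultimately have "z = z'" using unique by blast
        then show "p = p'" using yz \<open>y = y'\<close> by simp
      qed
      then show ?thesis using gV finV V(3) by (metis card_inj_on_le)
    qed
  qed
  have symA: "A u v \<Longrightarrow> A v u" for u v
    by (cases u; cases v) (simp add: A_eq mult.commute add.commute)
  obtain h where h: "bij_betw h {..<n} Y"
    using finite_same_card_bij[of "{..<n}" Y] finY cardY by auto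
  define E where "E i j = A (h i) (h j)" for i j
  have img: "card {j \<in> {..<n}. P (h j)} = card {v \<in> Y. P v}" for P
  proof -
    have "bij_betw h {j \<in> {..<n}. P (h j)} {v \<in> Y. P v}"
      using h unfolding bij_betw_def inj_on_def by (auto simp: image_iff)
    then show ?thesis by (rule bij_betw_same_card)
  qed
  have hY: "h i \<in> Y" if "i < n" for i using h that by (auto simp: bij_betw_def)
  have hinj: "h i \<noteq> h j" if "i < n" "j < n" "i \<noteq> j" for i j
    using h that by (auto simp: bij_betw_def inj_on_def)
  have "card {j \<in> {..<n}. E i j} = 2 ^ a" if "i < n" for i
    using img[of "A (h i)"] deg[OF hY[OF that]] by (simp add: E_def)
  moreover have "card (common_nbrs {..<n} E i j) \<le> 2 ^ b" if "i < n" "j < n" "i \<noteq> j" for i j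
    using img[of "\<lambda>v. A (h i) v \<and> A (h j) v"] codeg[OF hY hY hinj, of i j] that
    by (simp add: E_def common_nbrs_def)
  moreover have "symp E" by (auto simp: symp_def E_def symA)
  ultimately show ?thesis unfolding n_def by blast
qed

subsection \<open>Counting independent sets\<close>

definition nbrs_in :: "('a \<Rightarrow> 'a \<Rightarrow> bool) \<Rightarrow> 'a set \<Rightarrow> 'a \<Rightarrow> nat" where
  "nbrs_in E B v = card {u \<in> B. E v u}"

lemma real_card_filter: "finite B \<Longrightarrow> real (card {u \<in> B. P u}) = (\<Sum>u\<in>B. of_bool (P u))"
  by (simp add: of_bool_def sum.If_cases Int_def)

text \<open>A substitute for an eigenvalue bound. Since n s = q^2, the average of
  \<open>nbrs_in E B v\<close> over v is s|B|/q. Expanding the square about this mean, the codegree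
  bound makes the three terms of order s|B|^2 cancel, and only the diagonal pairs, q each,
  remain.\<close>

lemma second_moment_nbrs:
  fixes q s :: real
  assumes "finite Y" "B \<subseteq> Y" "symp E" and q: "q > 0" "s > 0"
    and size: "real (card Y) * s = q\<^sup>2"
    and deg: "\<And>v. v \<in> Y \<Longrightarrow> real (nbrs_in E Y v) = q"
    and codeg: "\<And>u v. \<lbrakk>u \<in> Y; v \<in> Y; u \<noteq> v\<rbrakk> \<Longrightarrow> real (card (common_nbrs Y E u v)) \<le> s"
  shows "(\<Sum>v\<in>Y. (real (nbrs_in E B v) - s * real (card B) / q)\<^sup>2) \<le> q * real (card B)"
proof -
  have finB: "finite B" using assms(1,2) finite_subset by blast
  have sym: "E u v = E v u" for u v using \<open>symp E\<close> by (auto dest: sympD)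
  define \<mu> where "\<mu> = s * real (card B) / q"
  have first: "(\<Sum>v\<in>Y. real (nbrs_in E B v)) = q * real (card B)"
  proof -
    have "(\<Sum>v\<in>Y. real (nbrs_in E B v)) = (\<Sum>u\<in>B. \<Sum>v\<in>Y. of_bool (E v u))"
      unfolding nbrs_in_def real_card_filter[OF finB] by (rule sum.swap)
    also have "\<dots> = (\<Sum>u\<in>B. real (nbrs_in E Y u))"
      unfolding nbrs_in_def real_card_filter[OF assms(1)] by (simp only: sym)
    also have "\<dots> = (\<Sum>u\<in>B. q)" using deg assms(2) by (intro sum.cong) auto
    finally show ?thesis by simp
  qed
  have second: "(\<Sum>v\<in>Y. (real (nbrs_in E B v))\<^sup>2) \<le> q * real (card B) + s * (real (card B))\<^sup>2"
  proof -
    have "(\<Sum>v\<in>Y. (real (nbrs_in E B v))\<^sup>2)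
        = (\<Sum>v\<in>Y. \<Sum>u\<in>B. \<Sum>w\<in>B. of_bool (E v u) * of_bool (E v w))"
      unfolding nbrs_in_def real_card_filter[OF finB] power2_eq_square sum_product ..
    also have "\<dots> = (\<Sum>u\<in>B. \<Sum>v\<in>Y. \<Sum>w\<in>B. of_bool (E v u) * of_bool (E v w))"
      by (rule sum.swap)
    also have "\<dots> = (\<Sum>u\<in>B. \<Sum>w\<in>B. \<Sum>v\<in>Y. of_bool (E v u) * of_bool (E v w))"
      by (intro sum.cong refl sum.swap)
    also have "\<dots> = (\<Sum>u\<in>B. \<Sum>w\<in>B. real (card (common_nbrs Y E u w)))"
      unfolding common_nbrs_def real_card_filter[OF assms(1)]
      by (intro sum.cong refl) (auto simp: sym)
    \<comment> \<open>The codegree bound covers distinct pairs only; for u = w the count is the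
      degree q.\<close>
    also have "\<dots> \<le> (\<Sum>u\<in>B. \<Sum>w\<in>B. s + (if u = w then q else 0))"
    proof (intro sum_mono)
      fix u w assume "u \<in> B" "w \<in> B"
      then have "u \<in> Y" "w \<in> Y" using assms(2) by auto
      then show "real (card (common_nbrs Y E u w)) \<le> s + (if u = w then q else 0)"
        using codeg[of u w] deg[of u] q by (cases "u = w") (auto simp: common_nbrs_def nbrs_in_def)
    qed
    also have "\<dots> = q * real (card B) + s * (real (card B))\<^sup>2"
      using finB by (simp add: sum.distrib power2_eq_square algebra_simps)
    finally show ?thesis .
  qed
  have "(\<Sum>v\<in>Y. (real (nbrs_in E B v) - \<mu>)\<^sup>2)
      = (\<Sum>v\<in>Y. (real (nbrs_in E B v))\<^sup>2) - 2 * \<mu> * (\<Sum>v\<in>Y. real (nbrs_in E B v)) + real (card Y) * \<mu>\<^sup>2"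
    by (simp add: power2_diff sum.distrib sum_subtractf sum_distrib_left mult_ac)
  also have "2 * \<mu> * (\<Sum>v\<in>Y. real (nbrs_in E B v)) = 2 * s * (real (card B))\<^sup>2"
    unfolding first using q by (simp add: \<mu>_def power2_eq_square)
  also have "real (card Y) * \<mu>\<^sup>2 = (real (card Y) * s) * s * (real (card B))\<^sup>2 / q\<^sup>2"
    by (simp add: \<mu>_def power2_eq_square)
  also have "\<dots> = s * (real (card B))\<^sup>2" unfolding size using q by simp
  finally show ?thesis using second by (simp add: \<mu>_def)
qed

text \<open>Chebyshev: each vertex of the set C of exceptions deviates from the mean \<mu> by at
  least \<mu>/2, so |C| |B| \<le> 4 q^3/s^2. As |C| \<le> |B|, this bounds |C|^2, and the result no
  longer depends on B.\<close>

lemma card_few_nbrs_le: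
  fixes q s :: real
  assumes "finite Y" "B \<subseteq> Y" "symp E" and q: "q > 0" "s > 0"
    and size: "real (card Y) * s = q\<^sup>2"
    and deg: "\<And>v. v \<in> Y \<Longrightarrow> real (nbrs_in E Y v) = q"
    and codeg: "\<And>u v. \<lbrakk>u \<in> Y; v \<in> Y; u \<noteq> v\<rbrakk> \<Longrightarrow> real (card (common_nbrs Y E u v)) \<le> s"
  shows "real (card {v \<in> B. real (nbrs_in E B v) \<le> s * real (card B) / (2 * q)}) \<le> 2 * q * sqrt q / s"
proof -
  define C where "C = {v \<in> B. real (nbrs_in E B v) \<le> s * real (card B) / (2 * q)}"
  define \<mu> where "\<mu> = s * real (card B) / q"
  have finB: "finite B" using assms(1,2) finite_subset by blast
  have CB: "card C \<le> card B" unfolding C_def by (intro card_mono finB) auto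
  have "real (card C) * (\<mu> / 2)\<^sup>2 = (\<Sum>v\<in>C. (\<mu> / 2)\<^sup>2)" by simp
  also have "\<dots> \<le> (\<Sum>v\<in>C. (real (nbrs_in E B v) - \<mu>)\<^sup>2)"
  proof (rule sum_mono)
    fix v assume "v \<in> C"
    then have "\<mu> / 2 \<le> \<mu> - real (nbrs_in E B v)" by (simp add: C_def \<mu>_def)
    moreover have "0 \<le> \<mu> / 2" using q by (simp add: \<mu>_def)
    ultimately show "(\<mu> / 2)\<^sup>2 \<le> (real (nbrs_in E B v) - \<mu>)\<^sup>2"
      by (subst power2_commute) (rule power_mono)
  qed
  also have "\<dots> \<le> (\<Sum>v\<in>Y. (real (nbrs_in E B v) - \<mu>)\<^sup>2)"
    using assms(1,2) by (intro sum_mono2) (auto simp: C_def)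
  also have "\<dots> \<le> q * real (card B)"
    unfolding \<mu>_def by (rule second_moment_nbrs[OF assms])
  finally have *: "real (card C) * (\<mu> / 2)\<^sup>2 \<le> q * real (card B)" .
  have "real (card C) \<le> 2 * q * sqrt q / s"
  proof (cases "card B = 0")
    case True
    then show ?thesis using CB q by simp
  next
    case False
    define c d where "c = real (card C)" and "d = real (card B)"
    have d: "d > 0" "c \<le> d" "c \<ge> 0" using False CB by (auto simp: c_def d_def)
    have "(s\<^sup>2 * c * d) * d \<le> (4 * q ^ 3) * d"
      using * q d by (simp add: \<mu>_def c_def[symmetric] d_def[symmetric] field_simps power2_eq_square power3_eq_cube)
    then have "s\<^sup>2 * c * d \<le> 4 * q ^ 3" using d by (simp only: mult_le_cancel_right)
    moreover have "s\<^sup>2 * c * c \<le> s\<^sup>2 * c * d" using d by (intro mult_left_mono) auto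
    moreover have "(s * c)\<^sup>2 = s\<^sup>2 * c * c" by (simp add: power2_eq_square)
    moreover have "(2 * q * sqrt q)\<^sup>2 = 4 * q ^ 3"
      using q by (simp add: power_mult_distrib power3_eq_cube power2_eq_square)
    ultimately have "(s * c)\<^sup>2 \<le> (2 * q * sqrt q)\<^sup>2" by linarith
    then have "s * c \<le> 2 * q * sqrt q" by (rule power2_le_imp_le) (use q in auto)
    then show ?thesis using q by (simp add: c_def field_simps)
  qed
  then show ?thesis by (simp add: C_def)
qed

definition indep_sets :: "('a \<Rightarrow> 'a \<Rightarrow> bool) \<Rightarrow> 'a set \<Rightarrow> nat \<Rightarrow> 'a set set" where
  "indep_sets E B m = {S. S \<subseteq> B \<and> card S = m \<and> finite S \<and> (\<forall>u\<in>S. \<forall>v\<in>S. u \<noteq> v \<longrightarrow> \<not> E u v)}"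

lemma finite_indep_sets: "finite B \<Longrightarrow> finite (indep_sets E B m)"
  by (rule finite_subset[of _ "Pow B"]) (auto simp: indep_sets_def)

lemma indep_sets_mono: "B \<subseteq> B' \<Longrightarrow> indep_sets E B m \<subseteq> indep_sets E B' m"
  by (auto simp: indep_sets_def)

text \<open>Double counting of pairs (S, v) with v in S: deleting v leaves an independent set among
  the non-neighbours of v. Iterating the factor \<open>Suc m\<close> produces the m! in the
  denominator later.\<close>

lemma Suc_times_card_indep_sets_le:
  assumes "finite B"
  shows "Suc m * card (indep_sets E B (Suc m))
    \<le> (\<Sum>v\<in>B. card (indep_sets E {u \<in> B. u \<noteq> v \<and> \<not> E v u} m))"
proof -
  let ?I = "indep_sets E B (Suc m)"
  have fin: "finite ?I" using assms by (rule finite_indep_sets)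
  have "Suc m * card ?I = (\<Sum>S\<in>?I. card S)" by (simp add: indep_sets_def)
  also have "\<dots> = (\<Sum>S\<in>?I. \<Sum>v\<in>B. of_bool (v \<in> S))"
  proof (rule sum.cong[OF refl])
    fix S assume "S \<in> ?I"
    then have "B \<inter> S = S" by (auto simp: indep_sets_def)
    then show "card S = (\<Sum>v\<in>B. of_bool (v \<in> S))"
      using assms by (simp add: of_bool_def sum.If_cases)
  qed
  also have "\<dots> = (\<Sum>v\<in>B. \<Sum>S\<in>?I. of_bool (v \<in> S))" by (rule sum.swap)
  also have "\<dots> = (\<Sum>v\<in>B. card {S \<in> ?I. v \<in> S})"
    using fin by (simp add: of_bool_def sum.If_cases Int_def)
  also have "\<dots> \<le> (\<Sum>v\<in>B. card (indep_sets E {u \<in> B. u \<noteq> v \<and> \<not> E v u} m))"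
  proof (rule sum_mono)
    fix v
    have "inj_on (\<lambda>S. S - {v}) {S \<in> ?I. v \<in> S}" by (auto simp: inj_on_def)
    moreover have "(\<lambda>S. S - {v}) ` {S \<in> ?I. v \<in> S} \<subseteq> indep_sets E {u \<in> B. u \<noteq> v \<and> \<not> E v u} m"
      by (auto simp: indep_sets_def)
    ultimately show "card {S \<in> ?I. v \<in> S} \<le> card (indep_sets E {u \<in> B. u \<noteq> v \<and> \<not> E v u} m)"
      using assms by (intro card_inj_on_le finite_indep_sets) auto
  qed
  finally show ?thesis .
qed

(* Build an independent set vertex by vertex. A vertex with few neighbours among the remaining
   candidates can be chosen in at most D ways; any other vertex shrinks the candidate set by the
   factor 1 - delta, so that it is empty after L such steps. *)
lemma card_indep_sets_le:
  fixes D \<delta> :: real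
  assumes "finite Y" "Y \<noteq> {}" "D \<ge> 0" "\<delta> < 1"
    and few: "\<And>B. B \<subseteq> Y \<Longrightarrow> real (card {v \<in> B. real (nbrs_in E B v) \<le> \<delta> * real (card B)}) \<le> D"
    and "B \<subseteq> Y" "real (card B) * (1 - \<delta>) ^ L < 1"
  shows "real (card (indep_sets E B m)) \<le> real (card Y) ^ L * (D + 1) ^ m / fact m"
  using assms(6,7)
proof (induction m arbitrary: B L)
  case 0
  have "indep_sets E B 0 \<subseteq> {{}}" by (auto simp: indep_sets_def)
  from card_mono[OF _ this] have "real (card (indep_sets E B 0)) \<le> 1" by simp
  moreover have "1 \<le> real (card Y) ^ L"
    using assms(1,2) by (intro one_le_power) (simp add: Suc_le_eq card_gt_0_iff)
  ultimately have "real (card (indep_sets E B 0)) \<le> real (card Y) ^ L" by (rule order_trans)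
  then show ?case by simp
next
  case (Suc m)
  let ?N = "real (card Y)"
  have finB: "finite B" using Suc.prems assms(1) finite_subset by blast
  show ?case
  proof (cases "B = {}")
    case True
    then have "indep_sets E B (Suc m) = {}" by (auto simp: indep_sets_def)
    then show ?thesis using assms(3) by simp
  next
    case False
    then have "card B \<ge> 1" using finB by (simp add: Suc_le_eq card_gt_0_iff)
    \<comment> \<open>With L = 0 the hypothesis would say |B| < 1.\<close>
    with Suc.prems(2) obtain L' where L: "L = Suc L'" by (cases L) auto
    define C where "C = {v \<in> B. real (nbrs_in E B v) \<le> \<delta> * real (card B)}"
    define R where "R v = {u \<in> B. u \<noteq> v \<and> \<not> E v u}" for v
    have RB: "R v \<subseteq> B" for v by (auto simp: R_def)
    have C: "C \<subseteq> B" "real (card C) \<le> D" using few[OF Suc.prems(1)] by (auto simp: C_def)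
    define P where "P = (D + 1) ^ m / fact m"
    have P: "P \<ge> 0" using assms(3) by (simp add: P_def)
    have bad: "real (card (indep_sets E (R v) m)) \<le> ?N ^ L * P" if "v \<in> C" for v
    proof -
      have "real (card (indep_sets E (R v) m)) \<le> real (card (indep_sets E B m))"
        using finB RB by (intro of_nat_mono card_mono finite_indep_sets indep_sets_mono)
      also have "\<dots> \<le> ?N ^ L * P" using Suc.IH[OF Suc.prems] by (simp add: P_def)
      finally show ?thesis .
    qed
    have good: "real (card (indep_sets E (R v) m)) \<le> ?N ^ L' * P" if v: "v \<in> B - C" for v
    proof -
      have "R v \<subseteq> B - {u \<in> B. E v u}" by (auto simp: R_def)
      then have "card (R v) \<le> card (B - {u \<in> B. E v u})" using finB by (intro card_mono) auto
      also have "\<dots> = card B - nbrs_in E B v"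
        unfolding nbrs_in_def using finB by (intro card_Diff_subset) auto
      finally have "card (R v) \<le> card B - nbrs_in E B v" .
      moreover have "nbrs_in E B v \<le> card B"
        unfolding nbrs_in_def using finB by (intro card_mono) auto
      ultimately have "real (card (R v)) \<le> real (card B) - real (nbrs_in E B v)" by linarith
      also have "\<dots> \<le> real (card B) * (1 - \<delta>)" using v by (auto simp: C_def algebra_simps)
      finally have "real (card (R v)) * (1 - \<delta>) ^ L' \<le> real (card B) * (1 - \<delta>) * (1 - \<delta>) ^ L'"
        using assms(4) by (intro mult_right_mono) auto
      also have "\<dots> < 1" using Suc.prems(2) by (simp add: L mult.assoc)
      finally show ?thesis using Suc.IH[of "R v" L'] RB Suc.prems(1) by (auto simp: P_def)
    qed
    have "real (Suc m) * real (card (indep_sets E B (Suc m))) \<le> (\<Sum>v\<in>B. real (card (indep_sets E (R v) m)))"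
      using Suc_times_card_indep_sets_le[OF finB, of m E]
      unfolding R_def of_nat_mult[symmetric] of_nat_sum[symmetric] of_nat_le_iff .
    also have "\<dots> = (\<Sum>v\<in>B - C. real (card (indep_sets E (R v) m))) + (\<Sum>v\<in>C. real (card (indep_sets E (R v) m)))"
      using C(1) finB by (rule sum.subset_diff)
    also have "\<dots> \<le> (\<Sum>v\<in>B - C. ?N ^ L' * P) + (\<Sum>v\<in>C. ?N ^ L * P)"
      by (intro add_mono sum_mono good bad)
    also have "\<dots> = real (card (B - C)) * (?N ^ L' * P) + real (card C) * (?N ^ L * P)" by simp
    \<comment> \<open>The up to n choices of a vertex with many neighbours are paid for by the drop
      from L to L'. Together they weigh as much as one more exceptional vertex, hence D + 1.\<close>
    also have "\<dots> \<le> ?N * (?N ^ L' * P) + D * (?N ^ L * P)"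
    proof (intro add_mono mult_right_mono)
      show "real (card (B - C)) \<le> ?N"
        using Suc.prems(1) assms(1) by (intro of_nat_mono card_mono) auto
    qed (use C P in auto)
    also have "\<dots> = ?N ^ L * (D + 1) * P" by (simp add: L algebra_simps)
    finally have "real (Suc m) * real (card (indep_sets E B (Suc m))) \<le> ?N ^ L * (D + 1) * P" .
    then have "real (card (indep_sets E B (Suc m))) \<le> ?N ^ L * (D + 1) * P / real (Suc m)"
      by (subst pos_le_divide_eq) (simp_all only: of_nat_0_less_iff zero_less_Suc mult.commute)
    also have "\<dots> = ?N ^ L * (D + 1) ^ Suc m / fact (Suc m)" by (simp add: P_def mult_ac)
    finally show ?thesis .
  qed
qed

subsection \<open>Random permutations\<close>

lemma exists_permutation_mapping:
  assumes "finite Y" "S \<subseteq> Y" "T \<subseteq> Y" "card S = card T"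
  shows "\<exists>\<pi>. \<pi> permutes Y \<and> \<pi> ` S = T"
proof -
  have fin: "finite S" "finite T" using assms finite_subset by auto
  obtain f where f: "bij_betw f S T" using finite_same_card_bij fin assms(4) by blast
  have "card (Y - S) = card (Y - T)" using assms fin by (simp add: card_Diff_subset)
  then obtain g where g: "bij_betw g (Y - S) (Y - T)"
    using finite_same_card_bij assms(1) by (metis finite_Diff)
  define \<pi> where "\<pi> x = (if x \<in> S then f x else if x \<in> Y then g x else x)" for x
  have "bij_betw \<pi> S T" using f by (rule bij_betw_cong[THEN iffD1, rotated]) (simp add: \<pi>_def)
  moreover have "bij_betw \<pi> (Y - S) (Y - T)"
    using g by (rule bij_betw_cong[THEN iffD1, rotated]) (simp add: \<pi>_def)
  ultimately have "bij_betw \<pi> (S \<union> (Y - S)) (T \<union> (Y - T))" by (rule bij_betw_combine) auto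
  moreover have "S \<union> (Y - S) = Y" "T \<union> (Y - T) = Y" using assms by auto
  ultimately have "bij_betw \<pi> Y Y" by simp
  then have "\<pi> permutes Y" by (rule bij_imp_permutes) (use assms(2) in \<open>auto simp: \<pi>_def\<close>)
  moreover have "\<pi> ` S = T" using \<open>bij_betw \<pi> S T\<close> by (simp add: bij_betw_def)
  ultimately show ?thesis by blast
qed

text \<open>In probabilistic terms, the image of S under a uniform permutation is a uniform m-set.
  The number of permutations sending T into I is the same for every m-set T, by composition with a
  permutation carrying S to T; summing over T instead, each permutation pulls I back to exactly |I|
  sets.\<close>

lemma card_permutations_into_family:
  assumes fin: "finite Y" and S: "S \<subseteq> Y" "card S = m" and I: "I \<subseteq> {T. T \<subseteq> Y \<and> card T = m}"
  shows "(card Y choose m) * card {\<pi>. \<pi> permutes Y \<and> \<pi> ` S \<in> I} = card {\<pi>. \<pi> permutes Y} * card I"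
proof -
  let ?P = "{\<pi>. \<pi> permutes Y}" and ?M = "{T. T \<subseteq> Y \<and> card T = m}"
  define N where "N S = card {\<pi> \<in> ?P. \<pi> ` S \<in> I}" for S
  have finP: "finite ?P" by (rule finite_permutations[OF fin])
  have finM: "finite ?M" using fin by simp
  have const: "N T = N S" if "T \<in> ?M" for T
  proof -
    have "T \<subseteq> Y" "card S = card T" using that S by auto
    then obtain \<tau> where \<tau>: "\<tau> permutes Y" "\<tau> ` S = T"
      using exists_permutation_mapping[OF fin S(1)] by blast
    have "bij_betw (\<lambda>\<pi>. \<pi> \<circ> \<tau>) {\<pi> \<in> ?P. \<pi> ` T \<in> I} {\<pi> \<in> ?P. \<pi> ` S \<in> I}"
    proof (rule bij_betwI[where g = "\<lambda>\<pi>. \<pi> \<circ> inv_into UNIV \<tau>"])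
      show "(\<lambda>\<pi>. \<pi> \<circ> \<tau>) \<in> {\<pi> \<in> ?P. \<pi> ` T \<in> I} \<rightarrow> {\<pi> \<in> ?P. \<pi> ` S \<in> I}"
        using \<tau> by (auto simp: permutes_compose image_comp)
      have "inv_into UNIV \<tau> ` T = S" using \<tau> permutes_inj[OF \<tau>(1)] by (auto simp: image_comp)
      then show "(\<lambda>\<pi>. \<pi> \<circ> inv_into UNIV \<tau>) \<in> {\<pi> \<in> ?P. \<pi> ` S \<in> I} \<rightarrow> {\<pi> \<in> ?P. \<pi> ` T \<in> I}"
        using \<tau>(1) by (auto simp: permutes_compose permutes_inv image_comp)
    qed (simp_all add: comp_assoc permutes_inv_o[OF \<tau>(1)])
    then show ?thesis unfolding N_def by (rule bij_betw_same_card)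
  qed
  have "(card Y choose m) * N S = (\<Sum>T\<in>?M. N T)"
    using const n_subsets[OF fin] by simp
  also have "\<dots> = (\<Sum>T\<in>?M. \<Sum>\<pi>\<in>?P. of_bool (\<pi> ` T \<in> I))"
    unfolding N_def using finP by (simp add: of_bool_def sum.If_cases Int_def)
  also have "\<dots> = (\<Sum>\<pi>\<in>?P. \<Sum>T\<in>?M. of_bool (\<pi> ` T \<in> I))" by (rule sum.swap)
  also have "\<dots> = (\<Sum>\<pi>\<in>?P. card I)"
  proof (rule sum.cong[OF refl])
    fix \<pi> assume "\<pi> \<in> ?P"
    then have \<pi>: "\<pi> permutes Y" by simp
    have "bij_betw ((`) \<pi>) {T \<in> ?M. \<pi> ` T \<in> I} I"
    proof (rule bij_betwI[where g = "(`) (inv_into UNIV \<pi>)"])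
      show "(`) (inv_into UNIV \<pi>) \<in> I \<rightarrow> {T \<in> ?M. \<pi> ` T \<in> I}"
      proof
        fix T assume T: "T \<in> I"
        have "inv_into UNIV \<pi> ` T \<subseteq> Y"
          using I T permutes_image[OF permutes_inv[OF \<pi>]] by blast
        moreover have "card (inv_into UNIV \<pi> ` T) = m"
          using I T permutes_inj_on[OF permutes_inv[OF \<pi>]] by (simp add: card_image subset_iff)
        moreover have "\<pi> ` inv_into UNIV \<pi> ` T = T"
          by (simp add: image_comp permutes_inv_o[OF \<pi>])
        ultimately show "inv_into UNIV \<pi> ` T \<in> {T \<in> ?M. \<pi> ` T \<in> I}" using T by simp
      qed
    qed (auto simp: image_comp permutes_inv_o[OF \<pi>])
    then have "card {T \<in> ?M. \<pi> ` T \<in> I} = card I" by (rule bij_betw_same_card)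
    then show "(\<Sum>T\<in>?M. of_bool (\<pi> ` T \<in> I)) = card I"
      using finM by (simp add: of_bool_def sum.If_cases Int_def)
  qed
  finally show ?thesis by (simp add: N_def)
qed

text \<open>Averaging: a random permutation keeps each member of F with probability |I| / (n choose
  m), so some permutation does no worse than the mean.\<close>

lemma exists_permutation_few_in_family:
  assumes fin: "finite Y" and F: "F \<subseteq> {T. T \<subseteq> Y \<and> card T = m}" and I: "I \<subseteq> {T. T \<subseteq> Y \<and> card T = m}"
  shows "\<exists>\<pi>. \<pi> permutes Y \<and> (card Y choose m) * card {S \<in> F. \<pi> ` S \<in> I} \<le> card F * card I"
proof (rule ccontr)
  let ?P = "{\<pi>. \<pi> permutes Y}"
  assume "\<not> ?thesis"
  then have gt: "card F * card I < (card Y choose m) * card {S \<in> F. \<pi> ` S \<in> I}" if "\<pi> \<in> ?P" for \<pi>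
    using that by auto
  have finP: "finite ?P" by (rule finite_permutations[OF fin])
  have finF: "finite F" using F fin by (auto intro: finite_subset[of _ "Pow Y"])
  have "id \<in> ?P" by (simp add: permutes_id)
  then have "?P \<noteq> {}" by blast
  then have "(\<Sum>\<pi>\<in>?P. card F * card I) < (\<Sum>\<pi>\<in>?P. (card Y choose m) * card {S \<in> F. \<pi> ` S \<in> I})"
    by (rule sum_strict_mono[OF finP _ gt])
  also have "\<dots> = (card Y choose m) * (\<Sum>\<pi>\<in>?P. \<Sum>S\<in>F. of_bool (\<pi> ` S \<in> I))"
    using finF by (simp add: of_bool_def sum.If_cases Int_def sum_distrib_left)
  also have "\<dots> = (card Y choose m) * (\<Sum>S\<in>F. \<Sum>\<pi>\<in>?P. of_bool (\<pi> ` S \<in> I))"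
    by (subst sum.swap) (rule refl)
  also have "\<dots> = (\<Sum>S\<in>F. (card Y choose m) * card {\<pi>. \<pi> permutes Y \<and> \<pi> ` S \<in> I})"
    using finP by (simp add: of_bool_def sum.If_cases Int_def sum_distrib_left)
  also have "\<dots> = (\<Sum>S\<in>F. card ?P * card I)"
    using F by (intro sum.cong refl card_permutations_into_family[OF fin _ _ I]) auto
  finally show False by simp
qed

text \<open>Start from all m-sets and apply the averaging step j + 1 times, each time shrinking the
  surviving family by |I| / (n choose m). The assumption says that fewer than one set survives.
  Denominators are multiplied out to stay in the naturals.\<close>

lemma exists_permutations_no_common:
  assumes fin: "finite Y" and I: "I \<subseteq> {T. T \<subseteq> Y \<and> card T = m}"
    and less: "card I ^ Suc j < (card Y choose m) ^ j"
  shows "\<exists>\<pi> :: nat \<Rightarrow> 'a \<Rightarrow> 'a. (\<forall>i. \<pi> i permutes Y) \<and>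
    {S. S \<subseteq> Y \<and> card S = m \<and> (\<forall>i\<le>j. \<pi> i ` S \<in> I)} = {}"
proof -
  let ?C = "card Y choose m"
  have step: "\<exists>\<pi> :: nat \<Rightarrow> 'a \<Rightarrow> 'a. (\<forall>i. \<pi> i permutes Y) \<and>
    ?C ^ l * card {S. S \<subseteq> Y \<and> card S = m \<and> (\<forall>i<l. \<pi> i ` S \<in> I)} \<le> ?C * card I ^ l" for l
  proof (induction l)
    case 0
    have "\<forall>i::nat. id permutes Y" by (simp only: permutes_id simp_thms)
    moreover have "?C ^ 0 * card {S. S \<subseteq> Y \<and> card S = m \<and> (\<forall>i<0::nat. id ` S \<in> I)} \<le> ?C * card I ^ 0"
      using n_subsets[OF fin] by simp
    ultimately show ?case by (intro exI[of _ "\<lambda>_. id"] conjI)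
  next
    case (Suc l)
    then obtain \<pi> :: "nat \<Rightarrow> 'a \<Rightarrow> 'a" where \<pi>: "\<And>i. \<pi> i permutes Y"
      and le: "?C ^ l * card {S. S \<subseteq> Y \<and> card S = m \<and> (\<forall>i<l. \<pi> i ` S \<in> I)} \<le> ?C * card I ^ l"
      by blast
    define F where "F = {S. S \<subseteq> Y \<and> card S = m \<and> (\<forall>i<l. \<pi> i ` S \<in> I)}"
    have "F \<subseteq> {T. T \<subseteq> Y \<and> card T = m}" by (auto simp: F_def)
    then obtain \<sigma> where \<sigma>: "\<sigma> permutes Y" "?C * card {S \<in> F. \<sigma> ` S \<in> I} \<le> card F * card I"
      using exists_permutation_few_in_family[OF fin _ I] by blast
    define \<pi>' where "\<pi>' = \<pi>(l := \<sigma>)"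
    have "{S. S \<subseteq> Y \<and> card S = m \<and> (\<forall>i<Suc l. \<pi>' i ` S \<in> I)} = {S \<in> F. \<sigma> ` S \<in> I}"
      by (auto simp: F_def \<pi>'_def less_Suc_eq)
    then have "?C ^ Suc l * card {S. S \<subseteq> Y \<and> card S = m \<and> (\<forall>i<Suc l. \<pi>' i ` S \<in> I)}
      = ?C ^ l * (?C * card {S \<in> F. \<sigma> ` S \<in> I})" by simp
    also have "\<dots> \<le> ?C ^ l * (card F * card I)" using \<sigma>(2) by (rule mult_le_mono2)
    also have "\<dots> \<le> (?C * card I ^ l) * card I"
      using mult_le_mono1[OF le, of "card I"] by (simp add: F_def mult.assoc)
    finally show ?case
      using \<pi> \<sigma>(1) by (intro exI[of _ \<pi>']) (auto simp: \<pi>'_def mult_ac)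
  qed
  obtain \<pi> :: "nat \<Rightarrow> 'a \<Rightarrow> 'a" where \<pi>: "\<And>i. \<pi> i permutes Y"
    and le: "?C ^ Suc j * card {S. S \<subseteq> Y \<and> card S = m \<and> (\<forall>i<Suc j. \<pi> i ` S \<in> I)} \<le> ?C * card I ^ Suc j"
    using step[of "Suc j"] by blast
  let ?F = "{S. S \<subseteq> Y \<and> card S = m \<and> (\<forall>i<Suc j. \<pi> i ` S \<in> I)}"
  have finF: "finite ?F" using fin by simp
  have "card ?F = 0"
  \<comment> \<open>The factor \<open>?C\<close> can be cancelled only if it is nonzero; otherwise
    there are no m-sets at all.\<close>
  proof (cases "?C = 0")
    case True
    then have "card {S. S \<subseteq> Y \<and> card S = m} = 0" by (simp only: n_subsets[OF fin])
    moreover have "finite {S. S \<subseteq> Y \<and> card S = m}" using fin by simp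
    ultimately have "{S. S \<subseteq> Y \<and> card S = m} = {}" by (simp only: card_0_eq)
    then have "?F = {}" by blast
    then show ?thesis by (simp only: card.empty)
  next
    case False
    have "?C * (?C ^ j * card ?F) \<le> ?C * card I ^ Suc j" using le by (simp add: mult_ac)
    then have "?C ^ j * card ?F \<le> card I ^ Suc j" using False by (simp only: mult_le_cancel1)
    then have "?C ^ j * card ?F < ?C ^ j" using less by (rule le_less_trans)
    moreover have "x = 0" if "?C ^ j * x < ?C ^ j" for x using that by (cases x) auto
    ultimately show ?thesis by blast
  qed
  then have "?F = {}" using finF by simp
  then show ?thesis using \<pi> by (intro exI[of _ \<pi>]) (simp add: less_Suc_eq_le)
qed

subsection \<open>Ramsey numbers\<close>

lemma has_copy_restrict:
  assumes "r \<le> n" "has_copy (colour_class (complete_graph r) c i) H"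
  shows "has_copy (colour_class (complete_graph n) c i) H"
proof -
  have sub: "{..<r} \<subseteq> {..<n}" using assms(1) by auto
  obtain f where f: "inj_on f (verts H)" "f ` verts H \<subseteq> {..<r}"
    and e: "\<And>e. e \<in> edges H \<Longrightarrow> f ` e \<in> [{..<r}]\<^bsup>2\<^esup> \<and> c (f ` e) = i"
    using assms(2) by (auto simp: has_copy_def colour_class_def complete_graph_def)
  have "f ` verts H \<subseteq> {..<n}" using f(2) sub by (rule order_trans)
  moreover have "f ` e \<in> [{..<n}]\<^bsup>2\<^esup> \<and> c (f ` e) = i" if "e \<in> edges H" for e
    using e[OF that] nsets_mono[OF sub] by blast
  ultimately show ?thesis
    using f(1) unfolding has_copy_def colour_class_def complete_graph_def by auto
qed

text \<open>The \<open>LEAST\<close> is attained, so if it were at most n, then c restricted to the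
  smaller complete graph would contain a forbidden copy, which is also a copy inside the larger
  one.\<close>

lemma ramsey_number_gt:
  assumes "\<And>H. H \<in> set Hs \<Longrightarrow> finite (verts H) \<and> edges H \<subseteq> [verts H]\<^bsup>2\<^esup>"
    and c: "c \<in> [{..<n}]\<^bsup>2\<^esup> \<rightarrow> {..<length Hs}"
    and no: "\<And>i. i < length Hs \<Longrightarrow> \<not> has_copy (colour_class (complete_graph n) c i) (Hs ! i)"
  shows "n < ramsey_number Hs"
proof (rule ccontr)
  assume "\<not> n < ramsey_number Hs"
  then have le: "ramsey_number Hs \<le> n" by simp
  have "ramsey_property (ramsey_number Hs) Hs"
    unfolding ramsey_number_def using ramsey_property_exists[OF assms(1)] by (rule LeastI_ex)
  moreover have "c \<in> edges (complete_graph (ramsey_number Hs)) \<rightarrow> {..<length Hs}"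
    using c nsets_mono[of "{..<ramsey_number Hs}" "{..<n}" 2] le by (auto simp: complete_graph_def)
  ultimately obtain i where "i < length Hs"
    "has_copy (colour_class (complete_graph (ramsey_number Hs)) c i) (Hs ! i)"
    unfolding ramsey_property_def by blast
  with no has_copy_restrict[OF le] show False by blast
qed

text \<open>Edges of \<open>E i\<close> receive a colour below j, overlaps being resolved by the
  least index, and all other pairs the last colour k; colours from j to k - 1 stay empty. Each
  colour class i < j lies inside \<open>E i\<close>, so it inherits the codegree bound.\<close>

lemma ramsey_number_rep_gt:
  fixes E :: "nat \<Rightarrow> nat \<Rightarrow> nat \<Rightarrow> bool"
  assumes "j \<le> k" "0 < t"
    and sym: "\<And>i. symp (E i)"
    and codeg: "\<And>i u v. \<lbrakk>i < j; u < n; v < n; u \<noteq> v\<rbrakk> \<Longrightarrow> card (common_nbrs {..<n} (E i) u v) < t"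
    and indep: "\<And>S. \<lbrakk>S \<subseteq> {..<n}; card S = m\<rbrakk> \<Longrightarrow> \<exists>i<j. \<exists>u\<in>S. \<exists>v\<in>S. u \<noteq> v \<and> E i u v"
  shows "n < ramsey_number_rep k (complete_bipartite_graph 2 t) (complete_graph m)"
proof -
  define c where "c e = (if \<exists>i<j. \<exists>u v. e = {u, v} \<and> E i u v
    then (LEAST i. i < j \<and> (\<exists>u v. e = {u, v} \<and> E i u v)) else k)" for e
  have c_less: "c e < j \<and> (\<exists>u v. e = {u, v} \<and> E (c e) u v)"
    if "\<exists>i<j. \<exists>u v. e = {u, v} \<and> E i u v" for e
  proof -
    have "\<exists>i. i < j \<and> (\<exists>u v. e = {u, v} \<and> E i u v)" using that by blast
    from LeastI_ex[OF this] show ?thesis using that unfolding c_def by simp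
  qed
  have c_k: "c e = k" if "\<not> (\<exists>i<j. \<exists>u v. e = {u, v} \<and> E i u v)" for e
    unfolding c_def by (rule if_not_P[OF that])
  have c_edge: "i < j \<and> E i u v" if c: "c {u, v} = i" "i < k" for u v i
  proof -
    have ex: "\<exists>i<j. \<exists>x y. {u, v} = {x, y} \<and> E i x y"
    proof (rule ccontr)
      assume "\<not> ?thesis"
      from c_k[OF this] c show False by simp
    qed
    then obtain x y where "{u, v} = {x, y}" "E i x y" "i < j"
      using c_less[OF ex] unfolding c(1) by blast
    then show ?thesis using sympD[OF sym, of i x y] by (auto simp: doubleton_eq_iff)
  qed
  let ?K = "complete_bipartite_graph 2 t"
  let ?Hs = "replicate k ?K @ [complete_graph m]"
  have "n < ramsey_number ?Hs"
  proof (rule ramsey_number_gt)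
    fix H assume "H \<in> set ?Hs"
    then have "H = ?K \<or> H = complete_graph m" by auto
    then show "finite (verts H) \<and> edges H \<subseteq> [verts H]\<^bsup>2\<^esup>"
      by (auto simp: complete_bipartite_graph_def complete_graph_def nsets_def)
  next
    show "c \<in> [{..<n}]\<^bsup>2\<^esup> \<rightarrow> {..<length ?Hs}"
    proof
      fix e
      have "c e \<le> k" using c_less[of e] c_k[of e] assms(1) by (metis le_eq_less_or_eq order.strict_trans2)
      then show "c e \<in> {..<length ?Hs}" by simp
    qed
  next
    fix i assume i: "i < length ?Hs"
    show "\<not> has_copy (colour_class (complete_graph n) c i) (?Hs ! i)"
    proof
      assume copy: "has_copy (colour_class (complete_graph n) c i) (?Hs ! i)"
      show False
      proof (cases "i < k")
        case True
        then have "?Hs ! i = ?K" by (simp add: nth_append)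
        with copy obtain f where f': "inj_on f (verts ?K)" "f ` verts ?K \<subseteq> {..<n}"
          and e': "\<And>e. e \<in> edges ?K \<Longrightarrow> c (f ` e) = i"
          by (auto simp: has_copy_def colour_class_def complete_graph_def)
        have f: "inj_on f {..<2 + t}" "f ` {..<2 + t} \<subseteq> {..<n}"
          using f' by (simp_all add: complete_bipartite_graph_def)
        have e: "c (f ` {x, y}) = i" if "x < 2" "2 \<le> y" "y < 2 + t" for x y
          by (rule e') (use that in \<open>auto simp: complete_bipartite_graph_def\<close>)
        have E: "i < j \<and> E i (f x) (f y)" if "x < 2" "2 \<le> y" "y < 2 + t" for x y
          using c_edge[of "f x" "f y" i] e[OF that] True by simp
        \<comment> \<open>The side of size t of a copy would consist of t common neighbours of the
          two vertices on the other side.\<close>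
        have "f ` {2..<2 + t} \<subseteq> common_nbrs {..<n} (E i) (f 0) (f 1)"
          using E f(2) by (auto simp: common_nbrs_def image_subset_iff)
        then have "card (f ` {2..<2 + t}) \<le> card (common_nbrs {..<n} (E i) (f 0) (f 1))"
          by (intro card_mono) (auto simp: common_nbrs_def)
        moreover have "card (f ` {2..<2 + t}) = t"
          by (subst card_image[OF inj_on_subset[OF f(1)]]) auto
        moreover have "f 0 < n" "f 1 < n" "f 0 \<noteq> f 1" 
          using f inj_onD[OF f(1), of 0 1] by (auto simp: image_subset_iff)
        \<comment> \<open>As t > 0 the copy has an edge, so its colour is not one of the empty
          ones.\<close>
        moreover have "i < j" using E[of 0 2] assms(2) by simp
        ultimately show False using codeg by (metis not_le)
      next
        case False
        then have "i = k" using i by simp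
        then have "?Hs ! i = complete_graph m" by (simp add: nth_append)
        with copy obtain f where f': "inj_on f (verts (complete_graph m))"
          "f ` verts (complete_graph m) \<subseteq> {..<n}"
          and e': "\<And>e. e \<in> edges (complete_graph m) \<Longrightarrow> c (f ` e) = k"
          unfolding \<open>i = k\<close> by (auto simp: has_copy_def colour_class_def complete_graph_def)
        have f: "inj_on f {..<m}" "f ` {..<m} \<subseteq> {..<n}"
          and e: "\<And>e. e \<in> [{..<m}]\<^bsup>2\<^esup> \<Longrightarrow> c (f ` e) = k"
          using f' e' by (simp_all add: complete_graph_def)
        have "card (f ` {..<m}) = m" using f(1) by (simp add: card_image)
        then obtain l x y where l: "l < j" "x < m" "y < m" "f x \<noteq> f y" "E l (f x) (f y)"
          using indep[OF f(2)] by auto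
        then have "{x, y} \<in> [{..<m}]\<^bsup>2\<^esup>" by (auto simp: nsets_def card_2_iff)
        then have "c {f x, f y} = k" using e[of "{x, y}"] by simp
        moreover have "c {f x, f y} < j" using c_less[of "{f x, f y}"] l by blast
        ultimately show False using assms(1) by simp
      qed
    qed
  qed
  then show ?thesis by (simp add: ramsey_number_rep_def)
qed

subsection \<open>Estimates\<close>

text \<open>The term m^m/m! is one summand of the series of e^m.\<close>

lemma fact_ge_power: "(real m / exp 1) ^ m \<le> fact m"
proof -
  have "real m ^ m / fact m = (\<Sum>i\<in>{m}. real m ^ i / fact i)" by simp
  also have "\<dots> \<le> (\<Sum>i. real m ^ i / fact i)"
    using summable_exp_generic[of "real m"]
    by (intro sum_le_suminf) (auto simp: divide_inverse scaleR_conv_of_real mult.commute)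
  also have "\<dots> = exp (real m)" by (simp add: exp_def divide_inverse mult.commute)
  also have "\<dots> = exp 1 ^ m" by (simp add: exp_of_nat_mult[symmetric])
  finally show ?thesis by (simp add: field_simps power_divide)
qed

text \<open>Here w is the gain per vertex in the exponent. Comparing f^(j+1) with ((n/m)^M)^j leaves
  exp((j+1) L ln n - M w), so the total gain M w has to beat the cost of the factor n^L in all j + 1
  copies.\<close>

lemma power_less_power_of_first_moment:
  fixes f n m \<beta> w C :: real
  assumes f: "0 \<le> f" "f \<le> n ^ L * \<beta> ^ M" and pos: "n > 0" "m > 0" "\<beta> \<ge> 0"
    and C: "(n / m) ^ M \<le> C"
    and \<beta>: "\<beta> ^ Suc j * (m / n) ^ j \<le> exp (- w)"
    and L: "real (Suc j) * (real L * ln n) < real M * w"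
  shows "f ^ Suc j < C ^ j"
proof -
  have "\<beta> ^ Suc j = \<beta> ^ Suc j * (m / n) ^ j * (n / m) ^ j"
    using pos by (simp add: power_divide)
  also have "\<dots> \<le> exp (- w) * (n / m) ^ j"
    using \<beta> pos by (intro mult_right_mono) auto
  finally have \<beta>': "\<beta> ^ Suc j \<le> exp (- w) * (n / m) ^ j" .
  have nL: "n ^ L = exp (real L * ln n)" using pos by (simp add: exp_of_nat_mult)
  have "f ^ Suc j \<le> (n ^ L * \<beta> ^ M) ^ Suc j" using f by (intro power_mono)
  also have "\<dots> = (n ^ L) ^ Suc j * (\<beta> ^ Suc j) ^ M"
    unfolding power_mult_distrib power_mult[symmetric] by (simp only: mult.commute)
  also have "\<dots> \<le> (n ^ L) ^ Suc j * (exp (- w) * (n / m) ^ j) ^ M"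
    using \<beta>' pos by (intro mult_left_mono power_mono) auto
  also have "\<dots> = exp (real (Suc j) * (real L * ln n) - real M * w) * ((n / m) ^ M) ^ j"
    unfolding nL power_mult_distrib exp_of_nat_mult[symmetric] exp_diff
    by (simp add: power_mult[symmetric] mult.commute exp_minus field_simps)
  also have "\<dots> < 1 * ((n / m) ^ M) ^ j"
    using L pos by (intro mult_strict_right_mono) auto
  also have "\<dots> \<le> C ^ j" using C pos by (simp add: power_mono)
  finally show ?thesis .
qed

text \<open>The shrinking rate s/(2q) is half the mean density, the threshold of the Chebyshev step;
  1 - x \<le> exp (-x) turns it into a number of rounds.\<close>

lemma power_one_minus_lt:
  fixes n q s :: real
  assumes "n \<ge> 1" "0 < s" "s \<le> q"
  shows "\<exists>L. n * (1 - s / (2 * q)) ^ L < 1 \<and> real L \<le> 2 * q / s * ln n + 1"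
proof -
  define x where "x = 2 * q / s * ln n"
  have "x \<ge> 0" using assms by (simp add: x_def)
  define L where "L = nat \<lfloor>x\<rfloor> + 1"
  \<comment> \<open>Strictness here is what makes the remaining candidate set have size below
    1.\<close>
  have L: "x < real L" "real L \<le> x + 1" using \<open>x \<ge> 0\<close> by (simp_all add: L_def) linarith+
  define \<delta> where "\<delta> = s / (2 * q)"
  have \<delta>: "\<delta> > 0" "\<delta> \<le> 1" "\<delta> * x = ln n" using assms by (simp_all add: \<delta>_def x_def)
  have "(1 - \<delta>) ^ L \<le> exp (- \<delta>) ^ L"
    using \<delta> exp_ge_add_one_self[of "- \<delta>"] by (intro power_mono) auto
  also have "\<dots> = exp (- (\<delta> * real L))" by (simp add: exp_of_nat_mult[symmetric] mult.commute)
  also have "\<dots> < exp (- (\<delta> * x))" using mult_strict_left_mono[OF L(1) \<delta>(1)] by simp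
  also have "\<dots> = 1 / n" using \<delta>(3) assms by (simp add: exp_minus inverse_eq_divide)
  finally have "n * (1 - \<delta>) ^ L < 1" using assms by (simp add: field_simps)
  then show ?thesis using L(2) by (auto simp: \<delta>_def x_def)
qed

(* There are j + 1 copies of the graph, and i is the exponent of the logarithm that they require. *)
lemma first_moment_condition:
  fixes f q s n m C :: real
  assumes ij: "(i, j) = (2, 1) \<or> (i, j) = (1, 2 :: nat)"
    and q: "4 \<le> q" "1 \<le> s" "s \<le> q" and n: "n * s = q\<^sup>2" and m: "m = real M" "M > 0"
    and large: "1000 * q * ln q ^ i \<le> s * m"
    and f: "0 \<le> f" "f \<le> n ^ L * (2 * q * sqrt q / s + 1) ^ M / fact M"
    and L: "real L \<le> 2 * q / s * ln n + 1"
    and C: "(n / m) ^ M \<le> C"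
  shows "f ^ Suc j < C ^ j"
proof -
  define l where "l = ln q"
  have m0: "m > 0" using m by simp
  have npos: "n > 0" using n q by (smt (verit) mult_nonpos_nonneg zero_less_power)
  have n_eq: "n = q\<^sup>2 / s" using n q by (simp add: field_simps)
  have "exp 1 ^ 3 \<le> (3 :: real) ^ 3" using exp_le by (intro power_mono) auto
  then have e3: "exp 1 ^ 3 \<le> (27 :: real)" by simp
  have "exp 1 \<le> q" using q exp_le by linarith
  then have l1: "l \<ge> 1" unfolding l_def using q by (simp add: ln_ge_iff)
  have "n \<le> q\<^sup>2" using n q npos mult_left_mono[of 1 s n] by simp
  then have "ln n \<le> ln (q\<^sup>2)" using npos q by (intro ln_mono) auto
  then have ln_n: "ln n \<le> 2 * l" using q by (simp add: l_def ln_realpow)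
  have "q * 1 \<le> q\<^sup>2 / s" using q by (simp add: field_simps power2_eq_square)
  then have "1 \<le> n" using q unfolding n_eq by linarith
  then have "ln n \<ge> 0" by simp
  have qs: "q / s \<ge> 1" using q by simp
  have Lln: "real L * ln n \<le> 10 * (q / s) * l\<^sup>2"
  proof -
    have "real L * ln n \<le> (2 * q / s * ln n + 1) * ln n" using L \<open>ln n \<ge> 0\<close> by (rule mult_right_mono)
    also have "\<dots> \<le> (2 * (q / s) * (2 * l) + 1) * (2 * l)"
      using mult_left_mono[OF ln_n, of "2 * (q / s)"] ln_n \<open>ln n \<ge> 0\<close> qs l1 q
      by (intro mult_mono add_mono) auto
    also have "\<dots> = 8 * (q / s) * l\<^sup>2 + 2 * (1 * l)" by (simp add: power2_eq_square algebra_simps)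
    also have "\<dots> \<le> 8 * (q / s) * l\<^sup>2 + 2 * ((q / s) * l\<^sup>2)"
      using qs l1 by (intro add_left_mono mult_left_mono mult_mono) (auto simp: power2_eq_square)
    finally show ?thesis by simp
  qed
  \<comment> \<open>The 3 absorbs the 1 in D + 1, since q^(3/2)/s \<ge> 1; the factor e/m comes from
    the lower bound on M!.\<close>
  define \<beta> where "\<beta> = 3 * exp 1 * (q * sqrt q) / (s * m)"
  have f': "f \<le> n ^ L * \<beta> ^ M"
  proof -
    define x where "x = q * sqrt q / s"
    have "1 * 1 \<le> q / s * sqrt q" using qs q by (intro mult_mono) auto
    then have "1 \<le> x" by (simp add: x_def)
    have eqs: "2 * q * sqrt q / s = 2 * x" "3 * (q * sqrt q) / s = 3 * x" by (simp_all add: x_def)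
    have "2 * q * sqrt q / s + 1 \<le> 3 * (q * sqrt q) / s" unfolding eqs using \<open>1 \<le> x\<close> by linarith
    then have "(2 * q * sqrt q / s + 1) ^ M \<le> (3 * (q * sqrt q) / s) ^ M"
      using q by (intro power_mono) auto
    then have "(2 * q * sqrt q / s + 1) ^ M / fact M \<le> (3 * (q * sqrt q) / s) ^ M / (m / exp 1) ^ M"
      using fact_ge_power[of M] m q by (intro frac_le) auto
    also have "\<dots> = (3 * (q * sqrt q) / s / (m / exp 1)) ^ M" by (simp only: power_divide)
    also have "3 * (q * sqrt q) / s / (m / exp 1) = \<beta>" by (simp add: \<beta>_def)
    finally have "n ^ L * ((2 * q * sqrt q / s + 1) ^ M / fact M) \<le> n ^ L * \<beta> ^ M"
      using npos by (intro mult_left_mono) auto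
    then show ?thesis using f(2) by simp
  qed
  have \<beta>0: "\<beta> \<ge> 0" using q m0 by (simp add: \<beta>_def)
  note main = power_less_power_of_first_moment[OF f(1) f' npos m0 \<beta>0 C]
  have sq: "sqrt q * sqrt q = q" using q by simp
  from ij show ?thesis
  proof
    assume "(i, j) = (2, 1)"
    then have ij: "i = 2" "j = 1" by auto
    have large': "1000 * q * l\<^sup>2 \<le> s * m" using large by (simp add: ij l_def)
    have "1 \<le> l\<^sup>2" using l1 by simp
    then have "1000 * q * 1 \<le> 1000 * q * l\<^sup>2" using q by (intro mult_left_mono) auto
    then have large'': "1000 * q \<le> s * m" using large' by linarith
    \<comment> \<open>Two copies: the gain per vertex is only the constant w = 1, so m has to exceed
      2 L ln n, of order (q/s) l^2.\<close>
    have "\<beta> ^ Suc j * (m / n) ^ j = 9 * exp 1 ^ 2 * q / (s * m)"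
      using q m0 sq by (simp add: ij \<beta>_def n_eq power2_eq_square field_simps)
    also have "\<dots> \<le> exp (- 1)"
    proof -
      have "(9 * exp 1 ^ 3) * q \<le> 1000 * q" using e3 q by (intro mult_right_mono) auto
      then have "9 * exp 1 ^ 3 * q \<le> s * m" using large'' by linarith
      then show ?thesis using q m0
        by (simp add: exp_minus field_simps power2_eq_square power3_eq_cube)
    qed
    finally show ?thesis
    proof (rule main)
      have "real (Suc j) * (real L * ln n) \<le> 20 * (q * l\<^sup>2) / s" using Lln by (simp add: ij)
      also have "\<dots> < m"
      proof -
        have "20 * (q * l\<^sup>2) < s * m" using large' mult_pos_pos[of s m] q m0 by linarith
        then show ?thesis using q by (simp add: pos_divide_less_eq mult.commute)
      qed
      finally show "real (Suc j) * (real L * ln n) < real M * 1" using m by simp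
    qed
  next
    assume "(i, j) = (1, 2)"
    then have ij: "i = 1" "j = 2" by auto
    have large': "1000 * q * l \<le> s * m" using large by (simp add: ij l_def)
    have "1000 * q * 1 \<le> 1000 * q * l" using l1 q by (intro mult_left_mono) auto
    then have large'': "1000 * q \<le> s * m" using large' by linarith
    \<comment> \<open>Three copies: a factor sqrt q is left over, so the gain is w = l/2 and cancels
      one logarithm in L ln n.\<close>
    have "\<beta> ^ Suc j * (m / n) ^ j = 27 * exp 1 ^ 3 * sqrt q / (s * m)"
      using q m0 sq by (simp add: ij \<beta>_def n_eq power2_eq_square power3_eq_cube field_simps)
    also have "\<dots> \<le> 1 / sqrt q"
    proof -
      \<comment> \<open>27 * 27 = 729 is the tightest demand on the constant 1000.\<close>
      have "(27 * exp 1 ^ 3) * q \<le> 1000 * q" using e3 q by (intro mult_right_mono) auto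
      then have "27 * exp 1 ^ 3 * sqrt q * sqrt q \<le> s * m" using large'' sq by (simp add: mult.assoc)
      then show ?thesis using q m0 by (simp add: field_simps)
    qed
    also have "\<dots> = exp (- (l / 2))" using q by (simp add: l_def exp_minus inverse_eq_divide ln_sqrt[symmetric])
    finally show ?thesis
    proof (rule main)
      have "real (Suc j) * (real L * ln n) \<le> (30 * (q * l) / s) * l" using Lln by (simp add: ij power2_eq_square)
      also have "\<dots> < (m / 2) * l"
      proof (rule mult_strict_right_mono)
        have "60 * (q * l) < s * m" using large' mult_pos_pos[of s m] q m0 by linarith
        then show "30 * (q * l) / s < m / 2" using q by (simp add: pos_divide_less_eq mult.commute)
      qed (use l1 in simp)
      finally show "real (Suc j) * (real L * ln n) < real M * (l / 2)" using m by simp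
    qed
  qed
qed

section \<open>Lower bounds for the Ramsey numbers\<close>

lemma ramsey_number_rep_gt_2_power:
  assumes ij: "(i, j) = (2, 1) \<or> (i, j) = (1, 2 :: nat)" and "j < k"
    and ab: "2 \<le> a" "b \<le> a" and t: "2 ^ b < t" and m: "0 < m"
    and large: "1000 * 2 ^ a * ln (2 ^ a) ^ i \<le> 2 ^ b * real m"
  shows "2 ^ (2 * a - b) < ramsey_number_rep k (complete_bipartite_graph 2 t) (complete_graph m)"
proof -
  define n :: nat where "n = 2 ^ (2 * a - b)"
  define q s :: real where "q = 2 ^ a" and "s = 2 ^ b"
  obtain E :: "nat \<Rightarrow> nat \<Rightarrow> bool" where E: "symp E"
    and deg: "\<And>u. u < n \<Longrightarrow> card {v \<in> {..<n}. E u v} = 2 ^ a"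
    and codeg: "\<And>u v. \<lbrakk>u < n; v < n; u \<noteq> v\<rbrakk> \<Longrightarrow> card (common_nbrs {..<n} E u v) \<le> 2 ^ b"
    using exists_small_codegree_graph[of a b] ab unfolding n_def by auto
  have q: "4 \<le> q" "1 \<le> s" "s \<le> q"
    using ab power_increasing[of 2 a "2::real"] power_increasing[of b a "2::real"]
    by (auto simp: q_def s_def)
  have ns: "real n * s = q\<^sup>2"
    using ab by (simp add: n_def q_def s_def power_add[symmetric] power_mult[symmetric] mult.commute)
  have n1: "1 \<le> real n" by (simp add: n_def)
  have few: "real (card {v \<in> B. real (nbrs_in E B v) \<le> s / (2 * q) * real (card B)}) \<le> 2 * q * sqrt q / s"
    if "B \<subseteq> {..<n}" for B
  proof -
    have "real (card {v \<in> B. real (nbrs_in E B v) \<le> s * real (card B) / (2 * q)}) \<le> 2 * q * sqrt q / s"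
    proof (rule card_few_nbrs_le[OF _ that E])
      show "real (card (common_nbrs {..<n} E u v)) \<le> s" if "u \<in> {..<n}" "v \<in> {..<n}" "u \<noteq> v" for u v
        using codeg[of u v] that of_nat_mono[of _ "2 ^ b", where 'a = real] by (force simp: s_def)
    qed (use q ns deg in \<open>auto simp: nbrs_in_def q_def\<close>)
    then show ?thesis by (simp add: mult_ac)
  qed
  obtain L where L: "real n * (1 - s / (2 * q)) ^ L < 1" "real L \<le> 2 * q / s * ln (real n) + 1"
    using power_one_minus_lt[OF n1, of s q] q by auto
  have f: "real (card (indep_sets E {..<n} m))
    \<le> real n ^ L * (2 * q * sqrt q / s + 1) ^ m / fact m"
    using card_indep_sets_le[of "{..<n}" "2 * q * sqrt q / s" "s / (2 * q)" E "{..<n}" L m] few L(1) q n1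
    by (auto simp: lessThan_empty_iff)
  show ?thesis
  proof (cases "m \<le> n")
    \<comment> \<open>There are no m-sets, so a single copy of the graph suffices. The other case
      needs m \<le> n for the bound (n/m)^m \<le> (n choose m).\<close>
    case False
    have "n < ramsey_number_rep k (complete_bipartite_graph 2 t) (complete_graph m)"
    proof (rule ramsey_number_rep_gt[where E = "\<lambda>_. E" and j = 1])
      show "card (common_nbrs {..<n} E u v) < t" if "u < n" "v < n" "u \<noteq> v" for u v
        using codeg[OF that] t by (rule le_less_trans)
      fix S :: "nat set" assume "S \<subseteq> {..<n}" "card S = m"
      then show "\<exists>i<1. \<exists>u\<in>S. \<exists>v\<in>S. u \<noteq> v \<and> E u v"
        using card_mono[of "{..<n}" S] False by simp
    qed (use assms(2) E t in auto)
    then show ?thesis by (simp add: n_def)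
  next
    case True
    let ?I = "indep_sets E {..<n} m"
    have "real (card ?I) ^ Suc j < real (n choose m) ^ j"
    proof (rule first_moment_condition[OF ij q ns refl m _ _ f L(2)])
      show "1000 * q * ln q ^ i \<le> s * real m" using large by (simp add: q_def s_def)
      show "(real n / real m) ^ m \<le> real (n choose m)" by (rule binomial_ge_n_over_k_pow_k[OF True])
    qed auto
    then have "card ?I ^ Suc j < (card {..<n} choose m) ^ j"
      unfolding of_nat_power[symmetric] of_nat_less_iff by simp
    moreover have "?I \<subseteq> {T. T \<subseteq> {..<n} \<and> card T = m}" by (auto simp: indep_sets_def)
    ultimately obtain \<pi> :: "nat \<Rightarrow> nat \<Rightarrow> nat"
      where \<pi>: "\<And>i. \<pi> i permutes {..<n}"
        and none: "{S. S \<subseteq> {..<n} \<and> card S = m \<and> (\<forall>i\<le>j. \<pi> i ` S \<in> ?I)} = {}"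
      using exists_permutations_no_common[OF finite_lessThan] by meson
    have "n < ramsey_number_rep k (complete_bipartite_graph 2 t) (complete_graph m)"
    proof (rule ramsey_number_rep_gt[where E = "\<lambda>i u v. E (\<pi> i u) (\<pi> i v)" and j = "Suc j"])
      show "symp (\<lambda>u v. E (\<pi> i u) (\<pi> i v))" for i using E by (auto simp: symp_def)
    next
      fix i u v assume uv: "u < n" "v < n" "u \<noteq> v"
      \<comment> \<open>A permuted copy is isomorphic to the original graph: \<open>\<pi> i\<close>
        embeds its common neighbourhoods into those of the image vertices.\<close>
      have in_n: "\<pi> i w < n \<longleftrightarrow> w < n" for w using permutes_in_image[OF \<pi>, of i w] by simp
      have inj: "inj (\<pi> i)" by (rule permutes_inj[OF \<pi>])
      have "\<pi> i ` common_nbrs {..<n} (\<lambda>u v. E (\<pi> i u) (\<pi> i v)) u v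
        \<subseteq> common_nbrs {..<n} E (\<pi> i u) (\<pi> i v)"
        by (auto simp: common_nbrs_def in_n)
      then have "card (common_nbrs {..<n} (\<lambda>u v. E (\<pi> i u) (\<pi> i v)) u v)
        \<le> card (common_nbrs {..<n} E (\<pi> i u) (\<pi> i v))"
        by (intro card_inj_on_le[of "\<pi> i"] inj_on_subset[OF inj]) (auto simp: common_nbrs_def)
      also have "\<dots> \<le> 2 ^ b" using uv in_n inj by (intro codeg) (auto dest: injD)
      also note t
      finally show "card (common_nbrs {..<n} (\<lambda>u v. E (\<pi> i u) (\<pi> i v)) u v) < t" .
    next
      fix S :: "nat set" assume S: "S \<subseteq> {..<n}" "card S = m"
      with none obtain i where i: "i \<le> j" "\<pi> i ` S \<notin> ?I" by blast
      have "\<pi> i ` S \<subseteq> {..<n}" using S(1) permutes_image[OF \<pi>, of i] by blast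
      moreover have "card (\<pi> i ` S) = m" using S(2) permutes_inj_on[OF \<pi>] by (simp add: card_image)
      moreover have "finite (\<pi> i ` S)" using S(1) finite_subset by blast
      ultimately have "\<exists>u\<in>S. \<exists>v\<in>S. \<pi> i u \<noteq> \<pi> i v \<and> E (\<pi> i u) (\<pi> i v)"
        using i(2) by (auto simp: indep_sets_def)
      then show "\<exists>i<Suc j. \<exists>u\<in>S. \<exists>v\<in>S. u \<noteq> v \<and> E (\<pi> i u) (\<pi> i v)"
        using i(1) unfolding less_Suc_eq_le by metis
    qed (use assms(2) t in auto)
    then show ?thesis by (simp add: n_def)
  qed
qed

text \<open>Colour all of K_t with the first colour: t vertices are too few for K_{2,t}, and the
  last colour has no edge while m \<ge> 2.\<close>

lemma ramsey_number_rep_gt_trivial: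
  assumes "1 \<le> k" "2 \<le> t" "2 \<le> m"
  shows "t < ramsey_number_rep k (complete_bipartite_graph 2 t) (complete_graph m)"
proof (rule ramsey_number_rep_gt[where E = "\<lambda>_. (\<noteq>)" and j = 1])
  fix u v :: nat assume uv: "u < t" "v < t" "u \<noteq> v"
  have "common_nbrs {..<t} (\<noteq>) u v \<subseteq> {..<t} - {u}" by (auto simp: common_nbrs_def)
  then have "card (common_nbrs {..<t} (\<noteq>) u v) \<le> card ({..<t} - {u})" by (intro card_mono) auto
  also have "\<dots> < t" using uv(1) by simp
  finally show "card (common_nbrs {..<t} (\<noteq>) u v) < t" .
next
  fix S :: "nat set" assume "S \<subseteq> {..<t}" "card S = m"
  then have "\<not> card S \<le> 1" using assms(3) by simp
  moreover have "finite S" using \<open>S \<subseteq> {..<t}\<close> finite_subset by blast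
  ultimately show "\<exists>i<1::nat. \<exists>u\<in>S. \<exists>v\<in>S. u \<noteq> v \<and> u \<noteq> v" by (auto simp: card_le_Suc0_iff_eq)
qed (use assms in \<open>auto simp: symp_def\<close>)

text \<open>With p = ln(mt)^i and t/2 \<le> s < t, the first moment condition admits q up to x =
  ms/(1000p). The power of 2 with x/2 < q \<le> x gives q^2/s \<ge> x^2/(4s), of order m^2 t/p^2;
  squaring p doubles the exponent i.\<close>

lemma ramsey_number_rep_lower_bound:
  assumes ij: "(i, j) = (2, 1) \<or> (i, j) = (1, 2 :: nat)" and "j < k" and t: "2 \<le> t" and m: "2 \<le> m"
  shows "1 / 4000\<^sup>2 * ((real m)\<^sup>2 * real t / ln (real m * real t) ^ (2 * i))
    \<le> real (ramsey_number_rep k (complete_bipartite_graph 2 t) (complete_graph m))"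
    (is "_ \<le> real ?r")
proof -
  define l where "l = ln (real m * real t)"
  have "2 * 2 \<le> real m * real t" using t m by (intro mult_mono) auto
  then have mt: "exp 1 \<le> real m * real t" using exp_le by linarith
  then have l1: "1 \<le> l" using ln_mono[OF mt exp_gt_zero] by (simp add: l_def)
  define p where "p = l ^ i"
  have p1: "1 \<le> p" using l1 by (simp add: p_def)
  have p2: "l ^ (2 * i) = p\<^sup>2" by (simp add: p_def power_mult[symmetric] mult.commute)
  \<comment> \<open>Rounding t - 1 rather than t keeps 2^b < t, which excludes K_{2,t}.\<close>
  have "1 \<le> t - 1" using t by simp
  then obtain b where "2 ^ b \<le> t - 1" "t - 1 < 2 ^ (b + 1)"
    using ex_power_ivl1[OF order_refl] by blast
  then have b: "2 ^ b < t" "t \<le> 2 * 2 ^ b" using t by auto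
  define s :: real where "s = 2 ^ b"
  have s: "1 \<le> s" "s \<le> real t" "real t \<le> 2 * s"
    using b of_nat_less_iff[of "2 ^ b" t, where 'a = real] of_nat_le_iff[of t "2 * 2 ^ b", where 'a = real]
    by (auto simp: s_def)
  define x where "x = real m * s / (1000 * p)"
  show ?thesis
  proof (cases "x < 4 * s")
    case True
    \<comment> \<open>This case fixes the constant 4000 = 4 * 1000: the claimed bound falls below
      t.\<close>
    then have "real m < 4000 * p" using s p1 by (simp add: x_def field_simps)
    then have "(real m)\<^sup>2 \<le> (4000 * p)\<^sup>2" by (intro power_mono) auto
    then have "1 / 4000\<^sup>2 * ((real m)\<^sup>2 * real t / p\<^sup>2) \<le> 1 / 4000\<^sup>2 * ((4000 * p)\<^sup>2 * real t / p\<^sup>2)"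
      by (intro mult_left_mono divide_right_mono mult_right_mono) auto
    also have "\<dots> = real t" using p1 by (simp add: power_mult_distrib)
    also have "\<dots> \<le> real ?r"
      using ramsey_number_rep_gt_trivial[of k t m] assms by simp
    finally show ?thesis unfolding l_def[symmetric] p2 .
  next
    case False
    then have x4: "4 * s \<le> x" by simp
    then have "4 \<le> x" using s by linarith
    then have "1 \<le> nat \<lfloor>x\<rfloor>" by (simp add: le_nat_iff le_floor_iff)
    then obtain a where a: "2 ^ a \<le> nat \<lfloor>x\<rfloor>" "nat \<lfloor>x\<rfloor> < 2 ^ (a + 1)"
      using ex_power_ivl1[OF order_refl] by blast
    define q :: real where "q = 2 ^ a"
    have "real (2 ^ a) \<le> x" using a(1) \<open>4 \<le> x\<close> by linarith
    then have qx: "q \<le> x" by (simp add: q_def)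
    have "x < real (2 ^ (a + 1))" using a(2) \<open>4 \<le> x\<close> by linarith
    then have xq: "x < 2 * q" by (simp add: q_def)
    \<comment> \<open>From 4s \<le> x < 2q follows a \<ge> b + 2, which gives both 2 \<le> a and b
      \<le> a; the threshold 4s was chosen for this.\<close>
    have "(2::real) ^ (b + 1) < 2 ^ a" using xq x4 by (simp add: q_def s_def)
    then have "b + 1 < a" by (rule power_less_imp_less_exp[rotated]) simp
    then have ab: "2 \<le> a" "b \<le> a" by auto
    have q0: "0 < q" by (simp add: q_def)
    have "q * 1 \<le> x * (1000 * p)" using qx p1 \<open>4 \<le> x\<close> by (intro mult_mono) auto
    also have "\<dots> = real m * s" using p1 by (simp add: x_def)
    also have "\<dots> \<le> real m * real t" using s by (intro mult_left_mono) auto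
    finally have "ln q \<le> l" unfolding l_def using q0 by (intro ln_mono) auto
    moreover have "0 \<le> ln q" by (simp add: q_def)
    ultimately have "ln q ^ i \<le> p" unfolding p_def by (rule power_mono)
    then have "1000 * q * ln q ^ i \<le> 1000 * x * p"
      using qx q0 p1 \<open>0 \<le> ln q\<close> by (intro mult_mono) auto
    also have "\<dots> = s * real m" using p1 by (simp add: x_def)
    finally have large: "1000 * 2 ^ a * ln (2 ^ a) ^ i \<le> 2 ^ b * real m" by (simp add: q_def s_def)
    have "2 ^ (2 * a - b) < ?r"
      using m by (intro ramsey_number_rep_gt_2_power[OF ij assms(2) ab b(1) _ large]) auto
    then have "real (2 ^ (2 * a - b)) \<le> real ?r" by (intro of_nat_mono) simp
    then have "real (2 ^ (2 * a - b)) * s \<le> real ?r * s" using s by (intro mult_right_mono) auto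
    moreover have "real (2 ^ (2 * a - b)) * s = q\<^sup>2"
      using ab by (simp add: q_def s_def power_add[symmetric] power_mult[symmetric] mult.commute)
    ultimately have "q\<^sup>2 \<le> real ?r * s" by simp
    then have "q\<^sup>2 / s \<le> real ?r" using s by (subst pos_divide_le_eq) linarith+
    \<comment> \<open>Although t \<le> 2s is available, 4s makes the next expression exactly
      (x/2)^2/s.\<close>
    have "1 / 4000\<^sup>2 * ((real m)\<^sup>2 * real t / p\<^sup>2) \<le> 1 / 4000\<^sup>2 * ((real m)\<^sup>2 * (4 * s) / p\<^sup>2)"
      using s by (intro mult_left_mono divide_right_mono) auto
    also have "\<dots> = (x / 2)\<^sup>2 / s"
      using s p1 by (simp add: x_def power_divide power_mult_distrib) (simp add: field_simps power2_eq_square)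
    also have "\<dots> \<le> q\<^sup>2 / s" using xq s \<open>4 \<le> x\<close> by (intro divide_right_mono power_mono) auto
    also note \<open>q\<^sup>2 / s \<le> real ?r\<close>
    finally show ?thesis unfolding l_def[symmetric] p2 .
  qed
qed

theorem theorem4:
  fixes k :: nat
  assumes "k \<ge> 3"
  shows "\<exists>\<rho>::real. \<rho> > 0 \<and>
    (\<forall>(t::nat) (m::int). t \<ge> 2 \<longrightarrow>
      (real_of_int m \<ge> 128 * (ln (real t))\<^sup>2 \<longrightarrow>
        real (ramsey_number [complete_bipartite_graph 2 t, complete_bipartite_graph 2 t,
                             complete_graph (nat m)])
          \<ge> \<rho> * ((real_of_int m)\<^sup>2 * real t / (ln (real_of_int m * real t)) ^ 4)) \<and>
      (real_of_int m \<ge> 16 * real k * ln (real t) \<longrightarrow>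
        real (ramsey_number_rep k (complete_bipartite_graph 2 t) (complete_graph (nat m)))
          \<ge> \<rho> * ((real_of_int m)\<^sup>2 * real t / (ln (real_of_int m * real t))\<^sup>2)))"
proof (intro exI[of _ "1 / 4000\<^sup>2"] conjI allI impI)
  fix t :: nat and m :: int
  assume t: "2 \<le> t"
  \<comment> \<open>With ln t \<ge> 1/2 the two hypotheses force m \<ge> 32 and m \<ge> 24
    respectively, so \<open>nat m\<close> agrees with m and is at least 2.\<close>
  have "1 / 2 \<le> ln (2 :: real)" using ln_le_minus_one[of "1 / 2 :: real"] by (simp add: ln_div)
  also have "\<dots> \<le> ln (real t)" using t by (intro ln_mono) auto
  finally have lt: "1 / 2 \<le> ln (real t)" .
  {
    assume "real_of_int m \<ge> 128 * (ln (real t))\<^sup>2"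
    moreover have "(1 / 2)\<^sup>2 \<le> (ln (real t))\<^sup>2" using lt by (intro power_mono) auto
    ultimately have "32 \<le> real_of_int m" by (simp add: power2_eq_square)
    then have m: "2 \<le> nat m" "real (nat m) = real_of_int m" by linarith+
    have Hs: "[complete_bipartite_graph 2 t, complete_bipartite_graph 2 t, complete_graph (nat m)]
      = replicate 2 (complete_bipartite_graph 2 t) @ [complete_graph (nat m)]"
      by (simp add: numeral_2_eq_2)
    then show "1 / 4000\<^sup>2 * ((real_of_int m)\<^sup>2 * real t / ln (real_of_int m * real t) ^ 4)
      \<le> real (ramsey_number [complete_bipartite_graph 2 t, complete_bipartite_graph 2 t,
                             complete_graph (nat m)])"
      using ramsey_number_rep_lower_bound[of 2 1 2 t "nat m"] t m
      unfolding Hs ramsey_number_rep_def by simp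
  next
    assume *: "real_of_int m \<ge> 16 * real k * ln (real t)"
    have "3 * (1 / 2) \<le> real k * ln (real t)" using lt assms by (intro mult_mono) auto
    with * have "24 \<le> real_of_int m" by simp
    then have m: "2 \<le> nat m" "real (nat m) = real_of_int m" by linarith+
    show "1 / 4000\<^sup>2 * ((real_of_int m)\<^sup>2 * real t / (ln (real_of_int m * real t))\<^sup>2)
      \<le> real (ramsey_number_rep k (complete_bipartite_graph 2 t) (complete_graph (nat m)))"
      using ramsey_number_rep_lower_bound[of 1 2 k t "nat m"] t m assms by simp
  }
qed simp

end
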